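(* Let $d\ge3$ and $f\in\mathcal{R}_d$. Assume that $M_f$ contains a non-zero nilpotent matrix $A\in\mathrm{Mat}_K(r,r)$, and let $n=\mathrm{index}(A)-1\ge1$. Then $f$ is a specialization of some $f_t\in\mathcal{R}_d[t_1,\dots,t_n]$ (that is, $f_0=f$, where $f_0$ is the value of $f_t$ at $t_1=\dots=t_n=0$) that splits regularly $n$ times inside $\mathcal{R}_d(t_1,\dots,t_n)$.
   Context: $K$ is a field, $r\ge 1$, $R=K[\partial_1,\dots,\partial_r]$ is a polynomial ring with the standard grading, and $\mathcal{R}=K[x_1,\dots,x_r]^{DP}=\bigoplus_{d\ge0}\mathcal{R}_d$ is the divided power ring: $\mathcal{R}_d$ has $K$-basis $x^{(\alpha)}=\prod_i x_i^{(\alpha_i)}$, $|\alpha|=d$, with multiplication generated by $x_i^{(a)}x_i^{(b)}=\binom{a+b}{a}x_i^{(a+b)}$. $R$ acts on $\mathcal{R}$ by $\partial^\beta(x^{(\alpha)})=x^{(\alpha-\beta)}$ (zero if some $\alpha_i<\beta_i$). $\mathrm{ann}_R(f)=\{D\in R:Df=0\}$, $R_e(f)=\{Df:D\in R_e\}$, $\partial=[\partial_1,\dots,\partial_r]^T$, and $$M_f=\{A\in\mathrm{Mat}_K(r,r):I_2(\partial\;A\partial)\subseteq\mathrm{ann}_R(f)\},$$ where $I_2(\partial\;A\partial)$ is the ideal of $R$ generated by the $2\times2$ minors of the $r\times2$ matrix with columns $\partial$ and $A\partial$. For a nilpotent matrix $A$, $\mathrm{index}(A)=\min\{k\ge1:A^k=0\}$.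 $\mathcal{R}_d[t_1,\dots,t_n]=\mathcal{R}_d\otimes_KK[t_1,\dots,t_n]\subseteq\mathcal{R}_d(t_1,\dots,t_n)=\mathcal{R}_d\otimes_KK(t_1,\dots,t_n)$, the latter being the degree $d$ forms of the divided power ring over the field $K(t_1,\dots,t_n)$. A form $f$ of degree $d$ (over any field) splits regularly $n$ times if $f=g_1+\dots+g_{n+1}$ with nonzero forms $g_i$ of degree $d$ such that $R_{d-1}(g_i)\cap\sum_{j\ne i}R_{d-1}(g_j)=0$ for all $i$; here, over $K(t_1,\dots,t_n)$, $R$ is replaced by $R\otimes_KK(t_1,\dots,t_n)$. *)

theory Defs
  imports
    "HOL-Analysis.Cartesian_Space"
    "HOL-Library.Poly_Mapping"
    "HOL-Library.Set_Algebras"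
    "HOL-Computational_Algebra.Fraction_Field"
begin

text \<open>
  The number of variables is the cardinality of a finite type \<open>'r\<close>, and an exponent vector
  \<open>\<alpha>\<close> is a finitely supported function \<open>'r \<Rightarrow>\<^sub>0 nat\<close>.

  \<open>('r, 'k) diffop\<close> is the polynomial ring \<open>R = 'k[\<partial>\<^sub>i | i \<in> 'r]\<close>; its ring structure is the
  convolution product of \<^theory>\<open>HOL-Library.Poly_Mapping\<close>.

  \<open>('r, 'k) dpow\<close> is the divided power ring; \<open>single \<alpha> c\<close> stands for \<open>c x\<^sup>(\<^sup>\<alpha>\<^sup>)\<close>. Only its structure
  as a graded vector space with an action of \<open>R\<close> is needed here. The operation \<open>*\<close> that the
  underlying type carries is not the divided power product and is never applied to elements
  of \<open>dpow\<close>.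
\<close>

type_synonym ('r, 'k) diffop = "('r \<Rightarrow>\<^sub>0 nat) \<Rightarrow>\<^sub>0 'k"
type_synonym ('r, 'k) dpow = "('r \<Rightarrow>\<^sub>0 nat) \<Rightarrow>\<^sub>0 'k"

definition mdeg :: "('r::finite \<Rightarrow>\<^sub>0 nat) \<Rightarrow> nat" where
  "mdeg \<alpha> = (\<Sum>i\<in>UNIV. Poly_Mapping.lookup \<alpha> i)"

text \<open>The homogeneous part of degree \<open>e\<close>, for \<open>diffop\<close> as well as for \<open>dpow\<close>.\<close>

definition homog :: "nat \<Rightarrow> (('r::finite \<Rightarrow>\<^sub>0 nat) \<Rightarrow>\<^sub>0 'k::zero) set" where
  "homog e = {p. \<forall>\<alpha>\<in>Poly_Mapping.keys p. mdeg \<alpha> = e}"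

text \<open>
  The bilinear extension of \<open>\<partial>\<^sup>\<beta> (x\<^sup>(\<^sup>\<alpha>\<^sup>)) = x\<^sup>(\<^sup>\<alpha>\<^sup>-\<^sup>\<beta>\<^sup>)\<close>. The condition is written componentwise because
  \<open>\<le>\<close> on \<open>'r \<Rightarrow>\<^sub>0 nat\<close> is a lexicographic order.
\<close>

definition act :: "('r::finite, 'k::field) diffop \<Rightarrow> ('r, 'k) dpow \<Rightarrow> ('r, 'k) dpow" where
  "act D f = (\<Sum>\<beta>\<in>Poly_Mapping.keys D. \<Sum>\<alpha>\<in>Poly_Mapping.keys f.
     if \<forall>i. Poly_Mapping.lookup \<beta> i \<le> Poly_Mapping.lookup \<alpha> i
     then Poly_Mapping.single (\<alpha> - \<beta>) (Poly_Mapping.lookup D \<beta> * Poly_Mapping.lookup f \<alpha>) else 0)"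

definition ann :: "('r::finite, 'k::field) dpow \<Rightarrow> ('r, 'k) diffop set" where
  "ann f = {D. act D f = 0}"

definition derivs :: "nat \<Rightarrow> ('r::finite, 'k::field) dpow \<Rightarrow> ('r, 'k) dpow set" where
  "derivs e f = {act D f | D. D \<in> homog e}"

definition const_op :: "'k::field \<Rightarrow> ('r::finite, 'k) diffop" where
  "const_op c = Poly_Mapping.single 0 c"

definition partial_vec :: "('r::finite, 'k::field) diffop ^ 'r" where
  "partial_vec = (\<chi> i. Poly_Mapping.single (Poly_Mapping.single i 1) 1)"

definition mat_partial_vec :: "'k::field ^ 'r ^ 'r \<Rightarrow> ('r::finite, 'k) diffop ^ 'r" where
  "mat_partial_vec A = (\<chi> i j. const_op (A $ i $ j)) *v partial_vec"

text \<open>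
  The ideal generated by the \<open>2 \<times> 2\<close> minors of the matrix with columns \<open>u\<close> and \<open>v\<close>: ideals of a
  commutative ring are its submodules. The type \<open>'r\<close> carries no order, so each minor occurs
  together with its negative.
\<close>

definition ideal_minors2 :: "'a::comm_ring_1 ^ 'r \<Rightarrow> 'a ^ 'r::finite \<Rightarrow> 'a set" where
  "ideal_minors2 u v = module.span (*) {u $ i * v $ j - u $ j * v $ i | i j. i \<noteq> j}"

definition M_set :: "('r::finite, 'k::field) dpow \<Rightarrow> ('k ^ 'r ^ 'r) set" where
  "M_set f = {A. ideal_minors2 partial_vec (mat_partial_vec A) \<subseteq> ann f}"

text \<open>The operation \<open>^\<close> on vectors and matrices is componentwise, hence this definition.\<close>

definition mat_power :: "'k::field ^ 'r ^ 'r \<Rightarrow> nat \<Rightarrow> 'k ^ 'r ^ 'r::finite" where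
  "mat_power A k = ((**) A ^^ k) (mat 1)"

definition nilpotent_mat :: "'k::field ^ 'r ^ 'r::finite \<Rightarrow> bool" where
  "nilpotent_mat A \<longleftrightarrow> (\<exists>k. mat_power A k = 0)"

definition nil_index :: "'k::field ^ 'r ^ 'r::finite \<Rightarrow> nat" where
  "nil_index A = (LEAST k. 1 \<le> k \<and> mat_power A k = 0)"

text \<open>
  The sum over \<open>j\<close> is a sum of subspaces, in the sense of
  \<^theory>\<open>HOL-Library.Set_Algebras\<close>.
\<close>

definition splits_regularly :: "nat \<Rightarrow> nat \<Rightarrow> ('r::finite, 'k::field) dpow \<Rightarrow> bool" where
  "splits_regularly d n f \<longleftrightarrow>
    (\<exists>g. f = (\<Sum>i\<in>{1..n+1}. g i) \<and>
      (\<forall>i\<in>{1..n+1}. g i \<in> homog d \<and> g i \<noteq> 0 \<and>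
         derivs (d - 1) (g i) \<inter> (\<Sum>j\<in>{1..n+1} - {i}. derivs (d - 1) (g j)) = {0}))"

text \<open>
  The polynomial ring \<open>'k[t\<^sub>i | i \<in> 'n]\<close> and its field of fractions. The order on \<open>'n\<close> only
  serves to obtain the library's \<^class>\<open>idom\<close> instance.
\<close>

type_synonym ('n, 'k) tpoly = "('n \<Rightarrow>\<^sub>0 nat) \<Rightarrow>\<^sub>0 'k"
type_synonym ('n, 'k) tfrac = "('n, 'k) tpoly fract"

definition eval_tpoly :: "('n::finite \<Rightarrow> 'k) \<Rightarrow> ('n, 'k::field) tpoly \<Rightarrow> 'k" where
  "eval_tpoly a p = (\<Sum>m\<in>Poly_Mapping.keys p. Poly_Mapping.lookup p m * (\<Prod>i\<in>UNIV. a i ^ Poly_Mapping.lookup m i))"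

text \<open>Both maps act on the coefficients of a family \<open>f\<^sub>t\<close> with coefficients in \<open>'k[t]\<close>.\<close>

definition specialize ::
  "('n::finite \<Rightarrow> 'k) \<Rightarrow> ('r::finite, ('n, 'k::field) tpoly) dpow \<Rightarrow> ('r, 'k) dpow" where
  "specialize a ft = Poly_Mapping.map (eval_tpoly a) ft"

definition to_tfrac ::
  "('r::finite, ('n::{finite,linorder}, 'k::field) tpoly) dpow \<Rightarrow> ('r, ('n, 'k) tfrac) dpow" where
  "to_tfrac ft = Poly_Mapping.map (\<lambda>c. Fract c 1) ft"

end

theory Submission
  imports Defs "HOL-Library.Multiset" "HOL-Computational_Algebra.Polynomial"
begin

text \<open>
  Let \<open>W\<close> be the degree one part of \<open>R\<close>, with basis \<open>\<partial>\<^sub>i\<close>. A form \<open>f\<close> of degree \<open>d\<close> in the divided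
  power ring is the same thing as a symmetric \<open>d\<close>-linear form \<open>F\<close> on \<open>W\<close>, its complete polarization
  \<open>F(\<ell>\<^sub>1, \<dots>, \<ell>\<^sub>d) = \<ell>\<^sub>1 \<cdots> \<ell>\<^sub>d f\<close>. Let \<open>T\<close> be the endomorphism \<open>\<partial>\<^sub>j \<mapsto> (A\<partial>)\<^sub>j\<close> of \<open>W\<close>, whose matrix is the
  transpose of \<open>A\<close>. The minors of \<open>(\<partial> A\<partial>)\<close> annihilate \<open>f\<close> exactly when \<open>T\<close> is self-adjoint for \<open>F\<close>,
  that is, when \<open>T\<close> can be moved from one argument of \<open>F\<close> to another
  (\<open>M_set_self_adjoint\<close>). So \<open>F\<close> is balanced over the ring \<open>K[X]/(X\<^sup>n\<^sup>+\<^sup>1)\<close>, where \<open>X\<close> acts as \<open>T\<close>.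

  The idea is to deform the nilpotent ring \<open>K[X]/(X\<^sup>n\<^sup>+\<^sup>1)\<close> into the product of fields
  \<open>L[X]/(\<Prod>\<^sub>i(X - s\<^sub>i))\<close>, where \<open>L = K(t\<^sub>1, \<dots>, t\<^sub>n)\<close>, \<open>s\<^sub>0 = 0\<close>, \<open>s\<^sub>i = t\<^sub>i\<close>, and to carry \<open>W\<close> and \<open>F\<close>
  along. The module \<open>W\<close> is a sum of cyclic modules with generators \<open>e\<close>; a chain \<open>e, Te, T\<^sup>2e, \<dots>\<close> is
  to be read as \<open>N\<^sub>0(X)e, N\<^sub>1(X)e, N\<^sub>2(X)e, \<dots>\<close> with the Newton polynomials
  \<open>N\<^sub>m(X) = (X - s\<^sub>0) \<cdots> (X - s\<^sub>m\<^sub>-\<^sub>1)\<close>, which become \<open>X\<^sup>m\<close> at \<open>t = 0\<close>. If \<open>C\<^sub>j\<close> denotes the operator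
  that sends \<open>T\<^sup>je\<close> to \<open>e\<close> and kills the other vectors of the chains
  (\<open>chain_system_exists\<close>), then \<open>Q(X) = \<Sum>\<^sub>j N\<^sub>j(X) C\<^sub>j\<close> performs this
  substitution. Writing \<open>c\<^sub>m(p)\<close> for the \<open>m\<close>-th coefficient of a polynomial \<open>p\<close> in the Newton basis, the
  deformed multilinear form is
  \<open>F\<^sub>t(\<ell>\<^sub>1, \<dots>, \<ell>\<^sub>d) = \<Sum>\<^sub>m\<^sub>\<le>\<^sub>n c\<^sub>m(F(T\<^sup>mQ(X)\<ell>\<^sub>1, Q(X)\<ell>\<^sub>2, \<dots>, Q(X)\<ell>\<^sub>d))\<close>.

  It has coefficients in \<open>K[t]\<close>. At \<open>t = 0\<close> the functional \<open>c\<^sub>m\<close> extracts the coefficient of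
  \<open>X\<^sup>m\<close>, and the self-adjointness of \<open>T\<close> gives \<open>F\<^sub>0 = F\<close>
  (\<open>truncated_polar_eq_polar\<close>). Over \<open>L\<close>, each \<open>c\<^sub>m(p)\<close> is a linear combination of
  the values \<open>p(s\<^sub>0), \<dots>, p(s\<^sub>m)\<close> (\<open>newton_coeffs_from_values\<close>), so that \<open>F\<^sub>t\<close> becomes a
  sum of \<open>n + 1\<close> forms \<open>g\<^sub>i\<close> in which any single argument enters \<open>g\<^sub>i\<close>
  only through \<open>T\<^sup>iQ(s\<^sub>i)\<close>. Hence the derivatives of
  order \<open>d - 1\<close> of \<open>g\<^sub>i\<close> are linear forms that factor through \<open>T\<^sup>iQ(s\<^sub>i)\<close>. The spaces of such linear forms
  are the duals of the eigenspaces of the deformed endomorphism and are therefore independent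
  (\<open>eigenspaces_independent\<close>).

  It may happen that some \<open>g\<^sub>i\<close> vanishes. Then \<open>t\<^sub>1\<lambda>\<^sup>(\<^sup>d\<^sup>)\<close> is added to it, where \<open>\<lambda>\<close> is a non-zero linear form with coefficients in
  \<open>K[t]\<close> that factors through \<open>T\<^sup>iQ(s\<^sub>i)\<close>. This changes neither the specialization at \<open>t = 0\<close> nor the
  independence.
\<close>

section \<open>Powers of matrices, linear functionals and rank one matrices\<close>

lemma mat_power_0 [simp]: "mat_power A 0 = mat 1"
  by (simp add: mat_power_def)

lemma mat_power_Suc: "mat_power A (Suc k) = A ** mat_power A k"
  by (simp add: mat_power_def)

lemma mat_power_add: "mat_power A (i + j) = mat_power A i ** mat_power A j"
  by (induction i) (simp_all add: mat_power_Suc matrix_mul_assoc)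

lemma mat_power_Suc_right: "mat_power A (Suc k) = mat_power A k ** A"
  using mat_power_add[of A k 1] by (simp add: mat_power_Suc)

lemma mat_power_commute:
  assumes "E ** A = A ** E"
  shows "E ** mat_power A k = mat_power A k ** E"
proof (induction k)
  case (Suc k)
  have "E ** mat_power A (Suc k) = (A ** E) ** mat_power A k"
    by (simp add: mat_power_Suc matrix_mul_assoc assms)
  also have "\<dots> = mat_power A (Suc k) ** E"
    by (simp add: mat_power_Suc matrix_mul_assoc[symmetric] Suc.IH)
  finally show ?case .
qed simp

lemma mat_power_eq_0_mono:
  assumes "mat_power A k = 0" "k \<le> l"
  shows "mat_power A l = 0"
proof -
  have "l = (l - k) + k" using assms(2) by simp
  then have "mat_power A l = mat_power A (l - k) ** mat_power A k"
    by (metis mat_power_add)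
  also have "\<dots> = 0" using assms(1) by (simp add: vec_eq_iff matrix_matrix_mult_def)
  finally show ?thesis .
qed

lemma mat_power_transpose: "mat_power (transpose A) k = transpose (mat_power A k)"
proof (induction k)
  case (Suc k)
  have "mat_power (transpose A) (Suc k) = transpose (mat_power A k ** A)"
    by (simp only: mat_power_Suc Suc.IH matrix_transpose_mul)
  then show ?case by (simp only: mat_power_Suc_right)
qed (simp add: transpose_mat)

definition dotv :: "'a::comm_ring_1 ^ 'r \<Rightarrow> 'a ^ 'r \<Rightarrow> 'a" where
  "dotv a v = (\<Sum>p\<in>UNIV. a $ p * v $ p)"

lemma dotv_right_add: "dotv a (v + w) = dotv a v + dotv a w"
  and dotv_right_scale: "dotv a (c *s v) = c * dotv a v"
  and dotv_right_0 [simp]: "dotv a 0 = 0"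
  by (simp_all add: dotv_def algebra_simps sum.distrib sum_distrib_left)

lemma dotv_right_diff: "dotv a (v - w) = dotv a v - dotv a w"
  by (simp add: dotv_def algebra_simps sum_subtractf)

lemma dotv_left_0 [simp]: "dotv 0 v = 0"
  and dotv_left_add: "dotv (a + b) v = dotv a v + dotv b v"
  and dotv_left_scale: "dotv (c *s a) v = c * dotv a v"
  by (simp_all add: dotv_def algebra_simps sum.distrib sum_distrib_left)

lemma dotv_right_sum: "dotv a (\<Sum>j\<in>J. v j) = (\<Sum>j\<in>J. dotv a (v j))"
  by (induction J rule: infinite_finite_induct) (simp_all add: dotv_right_add)

lemma dotv_left_sum: "dotv (\<Sum>j\<in>J. a j) v = (\<Sum>j\<in>J. dotv (a j) v)"
  by (induction J rule: infinite_finite_induct) (simp_all add: dotv_left_add)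

lemma dotv_vector_matrix: "dotv (a v* M) v = dotv a (M *v v)"
  unfolding dotv_def vector_matrix_mult_def matrix_vector_mult_def
  by (simp add: sum_distrib_left sum_distrib_right mult.assoc) (subst sum.swap, simp add: mult_ac)

lemma matrix_vector_scale:
  fixes M :: "'a::comm_ring_1 ^ 'r ^ 'm"
  shows "M *v (c *s v) = c *s (M *v v)"
  by (simp add: vec_eq_iff matrix_vector_mult_def sum_distrib_left mult_ac)

lemma matrix_vector_sum_right:
  fixes M :: "'a::comm_ring_1 ^ 'r ^ 'm"
  shows "M *v (\<Sum>j\<in>J. v j) = (\<Sum>j\<in>J. M *v v j)"
  by (induction J rule: infinite_finite_induct) (simp_all add: matrix_vector_right_distrib)

lemma matrix_vector_sum_left:
  fixes M :: "'j \<Rightarrow> 'a::comm_ring_1 ^ 'r ^ 'm"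
  shows "(\<Sum>j\<in>J. M j) *v v = (\<Sum>j\<in>J. M j *v v)"
  by (induction J rule: infinite_finite_induct) (simp_all add: matrix_vector_mult_add_rdistrib)

lemma matrix_mult_0 [simp]:
  fixes M :: "'a::semiring_1 ^ 'm ^ 'r"
  shows "M ** (0 :: 'a ^ 'q ^ 'm) = 0" "(0 :: 'a ^ 'r ^ 'q) ** M = 0"
  by (simp_all add: vec_eq_iff matrix_matrix_mult_def)

lemma matrix_add_rdistrib: "(B + C) ** A = B ** A + (C :: 'a::comm_ring_1 ^ 'm ^ 'p) ** A"
  by (simp add: vec_eq_iff matrix_matrix_mult_def sum.distrib algebra_simps)

lemma matrix_sub_ldistrib: "A ** (B - C) = A ** B - A ** (C :: 'a::comm_ring_1 ^ 'q ^ 'm)"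
  and matrix_sub_rdistrib: "(B' - C') ** A = B' ** A - (C' :: 'a::comm_ring_1 ^ 'm ^ 'p) ** A"
  by (simp_all add: vec_eq_iff matrix_matrix_mult_def sum_subtractf algebra_simps)

definition rank_one :: "'a::comm_ring_1 ^ 'm \<Rightarrow> 'a ^ 'r \<Rightarrow> 'a ^ 'r ^ 'm" where
  "rank_one e a = (\<chi> p q. e $ p * a $ q)"

lemma rank_one_mult_vec: "rank_one e a *v v = dotv a v *s e"
  by (simp add: vec_eq_iff rank_one_def matrix_vector_mult_def dotv_def sum_distrib_left mult_ac)

section \<open>Cyclic decomposition of a nilpotent matrix\<close>

text \<open>
  Meant for a projection \<open>E\<close> that commutes with \<open>A\<close>, where \<open>A\<close> is nilpotent. If the image of \<open>E\<close> has a basis of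
  chains \<open>e, Ae, A\<^sup>2e, \<dots>\<close>, then the operators \<open>C j\<close> that send \<open>A\<^sup>je\<close> to \<open>e\<close> and all other basis vectors to
  \<open>0\<close> have these properties. In particular \<open>C 0\<close> projects onto the span of the generators \<open>e\<close>. Working
  with the \<open>C j\<close> avoids indexing a basis by the cells of a Young diagram.
\<close>

definition chain_system :: "'k::field ^ 'r ^ 'r \<Rightarrow> 'k ^ 'r ^ 'r \<Rightarrow> nat \<Rightarrow> (nat \<Rightarrow> 'k ^ 'r ^ 'r::finite) \<Rightarrow> bool" where
  "chain_system A E n C \<longleftrightarrow>
    (\<forall>j. E ** C j = C j \<and> C j ** E = C j \<and> C 0 ** C j = C j) \<and>
    (\<forall>i j. i \<noteq> j \<longrightarrow> C i ** mat_power A j ** C 0 = 0) \<and>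
    (\<Sum>j\<le>n. mat_power A j ** C j) = E"

text \<open>
  In \<open>K[A]e0\<close> the functional \<open>\<phi>\<close> is non-zero on the socle, and multiplying \<open>e0\<close> by a suitable unit of
  \<open>K[A]\<close> makes \<open>\<phi>\<close> vanish on all lower powers. The unit is found one coefficient at a time: subtracting a
  multiple of \<open>A\<^sup>m\<^sup>+\<^sup>1e\<close> corrects the next value and leaves the earlier ones alone.
\<close>

lemma normalized_chain_generator:
  fixes \<phi> e0 :: "'k::field ^ 'r::finite"
  assumes top: "dotv \<phi> (mat_power A (k - 1) *v e0) = 1"
    and kill: "\<And>v. dotv \<phi> (mat_power A k *v v) = 0"
    and "E ** A = A ** E" "E *v e0 = e0" "1 \<le> k"
    and "m < k"
  shows "\<exists>e. E *v e = e \<and> (\<forall>i\<le>m. dotv \<phi> (mat_power A (k - 1 - i) *v e) = (if i = 0 then 1 else 0))"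
  using \<open>m < k\<close>
proof (induction m)
  case 0
  then show ?case using assms by auto
next
  case (Suc m)
  then obtain e where e: "E *v e = e"
    "\<And>i. i \<le> m \<Longrightarrow> dotv \<phi> (mat_power A (k - 1 - i) *v e) = (if i = 0 then 1 else 0)"
    by auto
  \<comment> \<open>the value that has to be corrected to zero\<close>
  define c where "c = dotv \<phi> (mat_power A (k - 1 - Suc m) *v e)"
  define e' where "e' = e - c *s (mat_power A (Suc m) *v e)"
  have "E *v e' = e'"
    using mat_power_commute[OF assms(3), of "Suc m"] e(1)
    by (simp add: e'_def matrix_vector_mult_diff_distrib matrix_vector_scale matrix_vector_mul_assoc)
       (simp add: matrix_vector_mul_assoc[symmetric])
  moreover have "dotv \<phi> (mat_power A (k - 1 - i) *v e') = (if i = 0 then 1 else 0)"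
    if "i \<le> Suc m" for i
  proof -
    have *: "dotv \<phi> (mat_power A (k - 1 - i) *v e') =
        dotv \<phi> (mat_power A (k - 1 - i) *v e) - c * dotv \<phi> (mat_power A ((k - 1 - i) + Suc m) *v e)"
      unfolding mat_power_add
      by (simp add: e'_def matrix_vector_mult_diff_distrib dotv_right_diff matrix_vector_scale
          dotv_right_scale matrix_vector_mul_assoc)
    show ?thesis
    proof (cases "i = Suc m")
      case True
      then have **: "(k - 1 - i) + Suc m = k - 1 - 0" using Suc.prems by simp
      show ?thesis unfolding * ** unfolding e(2)[OF le0] True c_def by simp
    next
      case False
      then have **: "(k - 1 - i) + Suc m = k + (m - i)" using Suc.prems that by simp
      have "mat_power A (k + (m - i)) *v e = mat_power A k *v (mat_power A (m - i) *v e)"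
        by (simp add: mat_power_add matrix_vector_mul_assoc)
      then show ?thesis unfolding * ** using e(2)[of i] that False by (simp add: kill)
    qed
  qed
  ultimately show ?case by blast
qed

text \<open>
  For a vector \<open>e\<close> of maximal order \<open>k\<close> and a functional \<open>\<phi>\<close> with \<open>\<phi>(A\<^sup>je) = 1\<close> for \<open>j = k - 1\<close> and
  \<open>\<phi>(A\<^sup>je) = 0\<close> otherwise, the vectors \<open>A\<^sup>je\<close> and the functionals \<open>\<phi>A\<^sup>k\<^sup>-\<^sup>1\<^sup>-\<^sup>j\<close> are dual bases. So
  \<open>\<Sum>\<^sub>j A\<^sup>je \<otimes> \<phi>A\<^sup>k\<^sup>-\<^sup>1\<^sup>-\<^sup>j\<close> is a projection onto the cyclic module generated by \<open>e\<close>, and it commutes with \<open>A\<close>.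
\<close>

lemma cyclic_summand:
  fixes A E :: "'k::field ^ 'r ^ 'r::finite"
  assumes EE: "E ** E = E" and EA: "E ** A = A ** E" and nil: "mat_power A (Suc n) = 0" and "E \<noteq> 0"
  shows "\<exists>E1 C. E1 \<noteq> 0 \<and> E1 ** E1 = E1 \<and> E1 ** A = A ** E1 \<and> E ** E1 = E1 \<and> E1 ** E = E1 \<and>
           chain_system A E1 n C"
proof -
  define k where "k = (LEAST k. mat_power A k ** E = 0)"
  have ex: "mat_power A (Suc n) ** E = 0" by (simp add: nil vec_eq_iff matrix_matrix_mult_def)
  have k: "mat_power A k ** E = 0" unfolding k_def by (rule LeastI[of _ "Suc n"]) (rule ex)
  have kn: "k \<le> Suc n" unfolding k_def by (rule Least_le) (rule ex)
  have k1: "1 \<le> k"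
  proof (rule ccontr)
    assume "\<not> 1 \<le> k"
    then have "k = 0" by simp
    with k \<open>E \<noteq> 0\<close> show False by simp
  qed
  have "mat_power A (k - 1) ** E \<noteq> 0"
    using k1 not_less_Least[of "k - 1" "\<lambda>k. mat_power A k ** E = 0"] unfolding k_def[symmetric] by auto
  then obtain u where u: "(mat_power A (k - 1) ** E) *v u \<noteq> 0"
    using matrix_eq[of "mat_power A (k - 1) ** E" 0] by auto
  then obtain p where p: "((mat_power A (k - 1) ** E) *v u) $ p \<noteq> 0"
    by (auto simp: vec_eq_iff)
  define \<phi>0 where "\<phi>0 = axis p (1 / ((mat_power A (k - 1) ** E) *v u) $ p)"
  \<comment> \<open>composing with \<open>E\<close> makes \<open>\<phi>\<close> vanish on \<open>A\<^sup>kv\<close> for all \<open>v\<close>, also outside the image of \<open>E\<close>\<close>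
  define \<phi> where "\<phi> = \<phi>0 v* E"
  have \<phi>E: "dotv \<phi> (E *v v) = dotv \<phi> v" for v
    by (simp add: \<phi>_def dotv_vector_matrix matrix_vector_mul_assoc EE)
  have \<phi>0: "dotv \<phi>0 ((mat_power A (k - 1) ** E) *v u) = 1"
  proof -
    have "dotv \<phi>0 w = w $ p / ((mat_power A (k - 1) ** E) *v u) $ p" for w
      unfolding dotv_def \<phi>0_def
      by (subst sum.remove[of _ p]) (auto simp: axis_def intro!: sum.neutral)
    then show ?thesis using p by simp
  qed
  have EAk: "E ** mat_power A i = mat_power A i ** E" for i by (rule mat_power_commute[OF EA])
  have top: "dotv \<phi> (mat_power A (k - 1) *v (E *v u)) = 1"
    using \<phi>0 by (simp add: \<phi>_def dotv_vector_matrix matrix_vector_mul_assoc matrix_mul_assoc EAk)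
      (metis EE matrix_mul_assoc)
  have kill: "dotv \<phi> (mat_power A k *v v) = 0" for v
    by (simp add: \<phi>_def dotv_vector_matrix matrix_vector_mul_assoc EAk k)
  have "E *v (E *v u) = E *v u" by (simp add: matrix_vector_mul_assoc EE)
  from normalized_chain_generator[where m = "k - 1", OF top kill EA this k1] k1
  obtain e where Ee: "E *v e = e"
    and e: "\<And>i. i < k \<Longrightarrow> dotv \<phi> (mat_power A (k - 1 - i) *v e) = (if i = 0 then 1 else 0)"
    by fastforce
  have ej: "dotv \<phi> (mat_power A j *v e) = (if j = k - 1 then 1 else 0)" for j
  proof (cases "j < k")
    case True
    then show ?thesis using e[of "k - 1 - j"] by auto
  next
    case False
    then have "mat_power A j = mat_power A k ** mat_power A (j - k)"
      using mat_power_add[of A k "j - k"] by simp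
    then show ?thesis using False kill k1 by (auto simp: matrix_vector_mul_assoc[symmetric])
  qed
  have ek: "mat_power A k *v e = 0"
    using k Ee by (metis matrix_vector_mul_assoc matrix_vector_mult_0)
  define C where "C j = (if j < k then rank_one e (\<phi> v* mat_power A (k - 1 - j)) else 0)" for j
  have C: "C j *v v = (if j < k then dotv \<phi> (mat_power A (k - 1 - j) *v v) else 0) *s e" for j v
    by (simp add: C_def rank_one_mult_vec dotv_vector_matrix)
  define E1 where "E1 = (\<Sum>j\<le>n. mat_power A j ** C j)"
  have E1: "E1 *v v = (\<Sum>j<k. dotv \<phi> (mat_power A (k - 1 - j) *v v) *s (mat_power A j *v e))" for v
  proof -
    have "E1 *v v = (\<Sum>j\<le>n. mat_power A j *v (C j *v v))"
      by (simp add: E1_def matrix_vector_sum_left matrix_vector_mul_assoc)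
    also have "\<dots> = (\<Sum>j<k. mat_power A j *v (C j *v v))"
      using kn by (intro sum.mono_neutral_right) (auto simp: C)
    finally show ?thesis by (simp add: C matrix_vector_scale)
  qed
  have E1e: "E1 *v e = e"
  proof -
    have "E1 *v e = (\<Sum>j<k. (if j = 0 then 1 else 0) *s (mat_power A j *v e))"
      unfolding E1 using k1 by (intro sum.cong) (auto simp: ej)
    also have "\<dots> = e" using k1 by (subst sum.remove[of _ 0]) (auto intro!: sum.neutral)
    finally show ?thesis .
  qed
  have \<phi>E1: "dotv \<phi> (mat_power A i *v (E1 *v v)) = dotv \<phi> (mat_power A i *v v)" if "i < k" for i v
  proof -
    have "dotv \<phi> (mat_power A i *v (E1 *v v)) =
        (\<Sum>j<k. dotv \<phi> (mat_power A (k - 1 - j) *v v) * dotv \<phi> (mat_power A (i + j) *v e))"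
      by (simp add: E1 matrix_vector_sum_right dotv_right_sum matrix_vector_scale dotv_right_scale
          matrix_vector_mul_assoc mat_power_add)
    also have "\<dots> = (\<Sum>j<k. if j = k - 1 - i then dotv \<phi> (mat_power A (k - 1 - j) *v v) else 0)"
      using that by (intro sum.cong) (auto simp: ej)
    also have "\<dots> = dotv \<phi> (mat_power A i *v v)" using that k1 by simp
    finally show ?thesis .
  qed
  have "E1 \<noteq> 0"
  proof
    assume "E1 = 0"
    then have "e = 0" using E1e by simp
    then show False using ej[of "k - 1"] by simp
  qed
  moreover have CE1: "C j ** E1 = C j" for j
    unfolding matrix_eq by (auto simp: matrix_vector_mul_assoc[symmetric] C \<phi>E1)
  moreover have "E1 ** E1 = E1"
    unfolding matrix_eq
  proof
    fix v
    have "E1 *v (E1 *v v) = (\<Sum>j<k. dotv \<phi> (mat_power A (k - 1 - j) *v (E1 *v v)) *s (mat_power A j *v e))"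
      by (rule E1)
    also have "\<dots> = (\<Sum>j<k. dotv \<phi> (mat_power A (k - 1 - j) *v v) *s (mat_power A j *v e))"
      using k1 by (simp add: \<phi>E1)
    also have "\<dots> = E1 *v v" by (rule E1[symmetric])
    finally show "(E1 ** E1) *v v = E1 *v v" by (simp add: matrix_vector_mul_assoc)
  qed
  moreover have "E1 ** A = A ** E1"
    unfolding matrix_eq
  proof
    fix v
    have 1: "mat_power A i *v (A *v v) = mat_power A (Suc i) *v v" for i v
      by (simp add: mat_power_Suc_right matrix_vector_mul_assoc)
    have 2: "A *v (mat_power A i *v v) = mat_power A (Suc i) *v v" for i v
      by (simp add: mat_power_Suc matrix_vector_mul_assoc)
    obtain l where l: "k = Suc l" using k1 by (cases k) auto
    have "E1 *v (A *v v) = (\<Sum>j<Suc l. dotv \<phi> (mat_power A (Suc (l - j)) *v v) *s (mat_power A j *v e))"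
      by (simp add: E1 1 l)
    also have "\<dots> = (\<Sum>j<l. dotv \<phi> (mat_power A (l - j) *v v) *s (mat_power A (Suc j) *v e))"
      using kill by (subst sum.lessThan_Suc_shift) (auto simp: l Suc_diff_Suc intro!: sum.cong)
    also have "\<dots> = (\<Sum>j<Suc l. dotv \<phi> (mat_power A (l - j) *v v) *s (mat_power A (Suc j) *v e))"
      using ek by (simp add: l)
    also have "\<dots> = A *v (E1 *v v)"
      by (simp add: E1 matrix_vector_sum_right matrix_vector_scale 2 l del: sum.lessThan_Suc)
    finally show "(E1 ** A) *v v = (A ** E1) *v v" by (simp add: matrix_vector_mul_assoc)
  qed
  moreover have "E ** E1 = E1"
  proof -
    have "E *v (mat_power A j *v e) = mat_power A j *v e" for j
      by (metis EAk Ee matrix_vector_mul_assoc)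
    then show ?thesis
      unfolding matrix_eq
      by (simp add: matrix_vector_mul_assoc[symmetric] E1 matrix_vector_sum_right matrix_vector_scale)
  qed
  moreover have "E1 ** E = E1"
  proof -
    have "dotv \<phi> (mat_power A j *v (E *v v)) = dotv \<phi> (mat_power A j *v v)" for j v
      by (metis EAk \<phi>E matrix_vector_mul_assoc)
    then show ?thesis
      unfolding matrix_eq by (simp add: matrix_vector_mul_assoc[symmetric] E1)
  qed
  moreover have "E1 ** C j = C j" for j
    unfolding matrix_eq by (simp add: matrix_vector_mul_assoc[symmetric] C matrix_vector_scale E1e)
  moreover have "C 0 ** C j = C j" for j
    unfolding matrix_eq using k1
    by (simp add: matrix_vector_mul_assoc[symmetric] C matrix_vector_scale dotv_right_scale ej)
  moreover have "C i ** mat_power A j ** C 0 = 0" if "i \<noteq> j" for i j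
    unfolding matrix_eq using k1 that
    by (auto simp: matrix_vector_mul_assoc[symmetric] C matrix_vector_scale dotv_right_scale)
      (auto simp: matrix_vector_mul_assoc mat_power_add[symmetric] ej)
  ultimately show ?thesis
    unfolding chain_system_def using E1_def by blast
qed

text \<open>
  A cyclic summand of maximal order splits off, and its complement \<open>E - E1\<close> has smaller rank. Operators on the two
  summands annihilate each other, so the two systems add up.
\<close>

lemma chain_system_exists:
  fixes A E :: "'k::field ^ 'r ^ 'r::finite"
  assumes "E ** E = E" and "E ** A = A ** E" and nil: "mat_power A (Suc n) = 0"
  shows "\<exists>C. chain_system A E n C"
  using assms(1,2)
proof (induction "vec.dim (range ((*v) E))" arbitrary: E rule: less_induct)
  case less
  show ?case
  proof (cases "E = 0")
    case True
    then have "chain_system A E n (\<lambda>_. 0)"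
      by (simp add: chain_system_def)
    then show ?thesis by blast
  next
    case False
    from cyclic_summand[OF less.prems nil this]
    obtain E1 C1 where E1: "E1 \<noteq> 0" "E1 ** E1 = E1" "E1 ** A = A ** E1" "E ** E1 = E1" "E1 ** E = E1"
      and C1: "chain_system A E1 n C1" by blast
    define E2 where "E2 = E - E1"
    have E2: "E2 ** E2 = E2" "E2 ** A = A ** E2" "E1 ** E2 = 0" "E2 ** E1 = 0" "E ** E2 = E2" "E2 ** E = E2"
      using less.prems E1 by (simp_all add: E2_def matrix_sub_ldistrib matrix_sub_rdistrib)
    have "vec.dim (range ((*v) E2)) < vec.dim (range ((*v) E))"
    proof (rule vec.dim_psubset)
      have sub: "vec.subspace (range ((*v) M))" for M :: "'k ^ 'r ^ 'r"
        by (intro vec.linear_subspace_image) (auto simp: vec.subspace_UNIV)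
      have "range ((*v) E2) \<subseteq> range ((*v) E)"
        using E2(5) by (metis matrix_vector_mul_assoc image_subsetI rangeI)
      moreover obtain v where v: "E1 *v v \<noteq> 0" using E1(1) by (auto simp: matrix_eq)
      have "E1 *v v \<in> range ((*v) E)"
        using E1(4) by (metis matrix_vector_mul_assoc rangeI)
      moreover have "E1 *v v \<notin> range ((*v) E2)"
      proof
        assume "E1 *v v \<in> range ((*v) E2)"
        then obtain w where "E1 *v v = E2 *v w" by auto
        then have "E1 *v v = E1 *v (E2 *v w)"
          using E1(2) by (metis matrix_vector_mul_assoc)
        then show False using v E2(3) by (simp add: matrix_vector_mul_assoc)
      qed
      ultimately have "range ((*v) E2) \<subset> range ((*v) E)" by blast
      then show "vec.span (range ((*v) E2)) \<subset> vec.span (range ((*v) E))"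
        using sub by (simp add: vec.span_eq_iff[THEN iffD2])
    qed
    from less.hyps[OF this E2(1,2)] obtain C2 where C2: "chain_system A E2 n C2" by blast
    have cs1: "E1 ** C1 j = C1 j" "C1 j ** E1 = C1 j" "C1 0 ** C1 j = C1 j"
      "i \<noteq> j \<Longrightarrow> C1 i ** mat_power A j ** C1 0 = 0" "(\<Sum>j\<le>n. mat_power A j ** C1 j) = E1" for i j
      using C1 by (simp_all add: chain_system_def)
    have cs2: "E2 ** C2 j = C2 j" "C2 j ** E2 = C2 j" "C2 0 ** C2 j = C2 j"
      "i \<noteq> j \<Longrightarrow> C2 i ** mat_power A j ** C2 0 = 0" "(\<Sum>j\<le>n. mat_power A j ** C2 j) = E2" for i j
      using C2 by (simp_all add: chain_system_def)
    have x12: "C1 i ** mat_power A j ** C2 l = 0" for i j l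
    proof -
      have "C1 i ** mat_power A j ** C2 l = C1 i ** (E1 ** mat_power A j) ** (E2 ** C2 l)"
        by (simp add: cs1 cs2 matrix_mul_assoc)
      also have "\<dots> = C1 i ** mat_power A j ** (E1 ** E2) ** C2 l"
        by (simp add: mat_power_commute[OF E1(3)] matrix_mul_assoc)
      finally show ?thesis by (simp add: E2)
    qed
    have x21: "C2 i ** mat_power A j ** C1 l = 0" for i j l
    proof -
      have "C2 i ** mat_power A j ** C1 l = C2 i ** (E2 ** mat_power A j) ** (E1 ** C1 l)"
        by (simp add: cs1 cs2 matrix_mul_assoc)
      also have "\<dots> = C2 i ** mat_power A j ** (E2 ** E1) ** C1 l"
        by (simp add: mat_power_commute[OF E2(2)] matrix_mul_assoc)
      finally show ?thesis by (simp add: E2)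
    qed
    define C where "C j = C1 j + C2 j" for j
    have "E ** C1 j = C1 j" "E ** C2 j = C2 j" "C1 j ** E = C1 j" "C2 j ** E = C2 j" for j
      using cs1(1,2)[of j] cs2(1,2)[of j] E1(4,5) E2(5,6) by (metis matrix_mul_assoc)+
    then have "E ** C j = C j" "C j ** E = C j" for j
      by (simp_all add: C_def matrix_add_ldistrib matrix_add_rdistrib)
    moreover have "C 0 ** C j = C j" for j
      using x12[of 0 0 j] x21[of 0 0 j]
      by (simp add: C_def matrix_add_ldistrib matrix_add_rdistrib cs1 cs2)
    moreover have "C i ** mat_power A j ** C 0 = 0" if "i \<noteq> j" for i j
      using that by (simp add: C_def matrix_add_ldistrib matrix_add_rdistrib cs1 cs2 x12 x21)
    moreover have "(\<Sum>j\<le>n. mat_power A j ** C j) = E"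
      by (simp add: C_def matrix_add_ldistrib sum.distrib cs1 cs2) (simp add: E2_def)
    ultimately have "chain_system A E n C" by (simp add: chain_system_def)
    then show ?thesis by blast
  qed
qed

section \<open>Exponent vectors and words\<close>

abbreviation unit_exp :: "'r \<Rightarrow> ('r \<Rightarrow>\<^sub>0 nat)" where
  "unit_exp i \<equiv> Poly_Mapping.single i 1"

definition word_exp :: "'r list \<Rightarrow> ('r \<Rightarrow>\<^sub>0 nat)" where
  "word_exp w = sum_list (map unit_exp w)"

lemma word_exp_Nil [simp]: "word_exp [] = 0"
  and word_exp_Cons [simp]: "word_exp (i # w) = unit_exp i + word_exp w"
  by (simp_all add: word_exp_def)

lemma lookup_word_exp: "Poly_Mapping.lookup (word_exp w) i = count (mset w) i"
  by (induction w) (auto simp: lookup_add lookup_single when_def)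

lemma mset_eq_if_word_exp_eq: "word_exp w = word_exp w' \<Longrightarrow> mset w = mset w'"
  by (simp add: multiset_eq_iff flip: lookup_word_exp)

lemma mdeg_add: "mdeg (\<alpha> + \<beta>) = mdeg \<alpha> + mdeg \<beta>"
  by (simp add: mdeg_def lookup_add sum.distrib)

lemma mdeg_unit_exp [simp]: "mdeg (Poly_Mapping.single i (Suc 0)) = Suc 0"
  by (simp add: mdeg_def lookup_single when_def)

lemma mdeg_eq_0_iff: "mdeg \<alpha> = 0 \<longleftrightarrow> \<alpha> = 0"
  by (auto simp: mdeg_def poly_mapping_eq_iff fun_eq_iff)

lemma mdeg_word_exp: "mdeg (word_exp w) = length w"
  by (induction w) (simp_all add: mdeg_add, simp add: mdeg_def)

lemma ex_word_exp:
  fixes \<alpha> :: "'r::finite \<Rightarrow>\<^sub>0 nat"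
  shows "\<exists>w. word_exp w = \<alpha>"
proof (induction "mdeg \<alpha>" arbitrary: \<alpha>)
  case 0
  then show ?case by (intro exI[of _ "[]"]) (simp add: mdeg_eq_0_iff)
next
  case (Suc d)
  then have "\<alpha> \<noteq> 0" by (metis mdeg_eq_0_iff nat.distinct(1))
  then obtain i where i: "Poly_Mapping.lookup \<alpha> i \<noteq> 0"
    by (metis lookup_zero poly_mapping_eqI)
  define \<beta> where "\<beta> = \<alpha> - unit_exp i"
  have \<alpha>: "\<alpha> = unit_exp i + \<beta>"
    unfolding \<beta>_def using i
    by (intro poly_mapping_eqI) (auto simp: lookup_add lookup_minus lookup_single when_def)
  then have "d = mdeg \<beta>" using Suc.hyps(2) by (simp add: mdeg_add)
  then obtain w where "word_exp w = \<beta>" using Suc.hyps(1) by blast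
  then show ?case using \<alpha> by (intro exI[of _ "i # w"]) simp
qed

text \<open>
  The coefficient of \<open>x\<^sup>(\<^sup>\<alpha>\<^sup>)\<close> of a form is the value of its polarization at any list of basis vectors
  with content \<open>\<alpha>\<close>; this is one such list.
\<close>

definition exp_word :: "('r::finite \<Rightarrow>\<^sub>0 nat) \<Rightarrow> 'r list" where
  "exp_word \<alpha> = (SOME w. word_exp w = \<alpha>)"

lemma word_exp_exp_word [simp]: "word_exp (exp_word \<alpha>) = \<alpha>"
  unfolding exp_word_def by (rule someI_ex) (rule ex_word_exp)

lemma length_exp_word [simp]: "length (exp_word \<alpha>) = mdeg \<alpha>"
  by (metis mdeg_word_exp word_exp_exp_word)

lemma mset_exp_word_add_unit: "mset (exp_word (\<beta> + unit_exp l)) = mset (l # exp_word \<beta>)"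
  by (rule mset_eq_if_word_exp_eq) (simp add: add.commute)

lemma finite_mdeg_eq: "finite {\<alpha> :: 'r::finite \<Rightarrow>\<^sub>0 nat. mdeg \<alpha> = d}"
proof (rule finite_subset)
  show "{\<alpha>. mdeg \<alpha> = d} \<subseteq> word_exp ` {w :: 'r list. set w \<subseteq> UNIV \<and> length w = d}"
    by (auto intro!: image_eqI[of _ _ "exp_word _"])
  show "finite (word_exp ` {w :: 'r list. set w \<subseteq> UNIV \<and> length w = d})"
    by (intro finite_imageI finite_lists_length_eq) simp
qed

section \<open>Complete polarization\<close>

text \<open>
  The value at \<open>vs\<close> of the multilinear form whose value at basis vectors \<open>\<partial>\<^sub>i, \<partial>\<^sub>j, \<dots>\<close> is \<open>h\<close> at
  the exponent of \<open>\<partial>\<^sub>i\<partial>\<^sub>j\<cdots>\<close>: each vector is contracted with the coefficient function \<open>h\<close>. As \<open>h\<close> is a plain function, scalars are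
  changed by composition.
\<close>

primrec polar :: "(('r::finite \<Rightarrow>\<^sub>0 nat) \<Rightarrow> 'a::comm_ring_1) \<Rightarrow> ('a ^ 'r) list \<Rightarrow> 'a" where
  "polar h [] = h 0"
| "polar h (v # vs) = (\<Sum>i\<in>UNIV. v $ i * polar (\<lambda>\<alpha>. h (\<alpha> + unit_exp i)) vs)"

lemma polar_axis: "polar h (map (\<lambda>i. axis i 1) w) = h (word_exp w)"
proof (induction w arbitrary: h)
  case (Cons i w)
  have "polar h (map (\<lambda>i. axis i 1) (i # w)) = (\<Sum>j\<in>UNIV. if j = i then h (word_exp w + unit_exp i) else 0)"
    unfolding polar.simps list.map Cons.IH by (intro sum.cong) (auto simp: axis_def)
  then show ?case by (simp add: add.commute)
qed simp

lemma polar_linear_form: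
  "polar (\<lambda>\<alpha>. \<Sum>j\<in>J. c j * h j \<alpha>) vs = (\<Sum>j\<in>J. c j * polar (h j) vs)"
proof (induction vs arbitrary: h)
  case (Cons v vs)
  show ?case
    unfolding polar.simps Cons.IH
    by (simp add: sum_distrib_left mult_ac) (rule sum.swap)
qed simp

lemma polar_dotv: "polar h (v # vs) = dotv (\<chi> i. polar h (axis i 1 # vs)) v"
proof -
  have "polar h (axis i 1 # vs) = polar (\<lambda>\<alpha>. h (\<alpha> + unit_exp i)) vs" for i
    by (simp add: axis_def) (subst sum.remove[of _ i]; simp)
  then show ?thesis by (simp add: dotv_def mult.commute)
qed

lemma polar_scale: "polar h ((c *s v) # vs) = c * polar h (v # vs)"
  by (metis polar_dotv dotv_right_scale)

lemma polar_sum: "polar h ((\<Sum>j\<in>J. v j) # vs) = (\<Sum>j\<in>J. polar h (v j # vs))"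
  by (subst (1 2) polar_dotv) (rule dotv_right_sum)

lemma polar_0: "polar h (0 # vs) = 0"
  by simp

lemma polar_matrix: "\<exists>a. \<forall>v. polar h (M *v v # vs) = dotv a v"
proof (intro exI allI)
  fix v
  show "polar h (M *v v # vs) = dotv ((\<chi> i. polar h (axis i 1 # vs)) v* M) v"
    unfolding dotv_vector_matrix by (rule polar_dotv)
qed

lemma polar_swap: "polar h (v # w # vs) = polar h (w # v # vs)"
  by (simp add: sum_distrib_left) (subst sum.swap, simp add: add_ac mult_ac)

lemma polar_mset: "mset vs = mset ws \<Longrightarrow> polar h vs = polar h ws"
proof (induction vs arbitrary: h ws)
  case (Cons v vs)
  have move: "polar h (xs @ v # ys) = polar h (v # xs @ ys)" for h xs ys
  proof (induction xs arbitrary: h)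
    case (Cons x xs)
    have "polar h ((x # xs) @ v # ys) = polar h (x # v # xs @ ys)"
      unfolding append_Cons polar.simps(2)[of h x] Cons.IH ..
    also have "\<dots> = polar h (v # (x # xs) @ ys)" using polar_swap[of h x v "xs @ ys"] by simp
    finally show ?case .
  qed simp
  from Cons.prems have "v \<in> set ws" by (metis list.set_intros(1) set_mset_mset)
  then obtain xs ys where ws: "ws = xs @ v # ys" by (meson split_list)
  with Cons.prems have "mset vs = mset (xs @ ys)" by simp
  then have "polar h (v # vs) = polar h (v # xs @ ys)" for h
    unfolding polar.simps using Cons.IH by metis
  then show ?case by (simp only: ws move)
qed simp

section \<open>Self-adjoint matrices\<close>

lemma matrix_vector_axis:
  fixes M :: "'a::comm_ring_1 ^ 'r ^ 'm"
  shows "(M *v axis i 1) $ l = M $ l $ i"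
  by (simp add: matrix_vector_mult_def axis_def if_distrib cong: if_cong)

text \<open>
  The condition \<open>polar h (M *v v # w # vs) = polar h (v # M *v w # vs)\<close>, tested on basis vectors. In this
  form it passes through ring homomorphisms.
\<close>

definition self_adjoint :: "(('r::finite \<Rightarrow>\<^sub>0 nat) \<Rightarrow> 'a::comm_ring_1) \<Rightarrow> 'a ^ 'r ^ 'r \<Rightarrow> bool" where
  "self_adjoint h M \<longleftrightarrow> (\<forall>\<alpha> i j. (\<Sum>l\<in>UNIV. M $ l $ i * h (\<alpha> + unit_exp j + unit_exp l)) =
     (\<Sum>l\<in>UNIV. M $ l $ j * h (\<alpha> + unit_exp i + unit_exp l)))"

lemma polar_self_adjoint:
  assumes "self_adjoint h M"
  shows "polar h (M *v v # w # vs) = polar h (v # M *v w # vs)"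
proof -
  have expand: "polar h (M *v v # w # vs) =
      (\<Sum>i\<in>UNIV. \<Sum>j\<in>UNIV. v $ i * w $ j * polar (\<lambda>\<alpha>. \<Sum>l\<in>UNIV. M $ l $ i * h (\<alpha> + unit_exp j + unit_exp l)) vs)"
    for v w
  proof -
    have "polar h (M *v v # w # vs) = (\<Sum>l\<in>UNIV. \<Sum>i\<in>UNIV. \<Sum>j\<in>UNIV.
        v $ i * w $ j * (M $ l $ i * polar (\<lambda>\<alpha>. h (\<alpha> + unit_exp j + unit_exp l)) vs))"
      by (simp add: matrix_vector_mult_def sum_product) (simp add: mult_ac)
    also have "\<dots> = (\<Sum>i\<in>UNIV. \<Sum>j\<in>UNIV. \<Sum>l\<in>UNIV.
        v $ i * w $ j * (M $ l $ i * polar (\<lambda>\<alpha>. h (\<alpha> + unit_exp j + unit_exp l)) vs))"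
      by (rule trans[OF sum.swap]) (rule sum.cong[OF refl], rule sum.swap)
    finally show ?thesis by (simp add: polar_linear_form sum_distrib_left)
  qed
  have "polar h (v # M *v w # vs) = polar h (M *v w # v # vs)" by (rule polar_swap)
  also have "\<dots> = (\<Sum>i\<in>UNIV. \<Sum>j\<in>UNIV. w $ i * v $ j *
      polar (\<lambda>\<alpha>. \<Sum>l\<in>UNIV. M $ l $ i * h (\<alpha> + unit_exp j + unit_exp l)) vs)"
    by (rule expand)
  also have "\<dots> = (\<Sum>i\<in>UNIV. \<Sum>j\<in>UNIV. w $ i * v $ j *
      polar (\<lambda>\<alpha>. \<Sum>l\<in>UNIV. M $ l $ j * h (\<alpha> + unit_exp i + unit_exp l)) vs)"
    using assms unfolding self_adjoint_def by (simp only:)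
  also have "\<dots> = polar h (M *v v # w # vs)"
    unfolding expand by (subst sum.swap) (simp add: mult_ac)
  finally show ?thesis ..
qed

lemma self_adjointI:
  assumes "\<And>v w vs. polar h (M *v v # w # vs) = polar h (v # M *v w # vs)"
  shows "self_adjoint h M"
  unfolding self_adjoint_def
proof (intro allI)
  fix \<alpha> i j
  have *: "polar h (M *v axis i 1 # axis j 1 # map (\<lambda>i. axis i 1) w) =
      (\<Sum>l\<in>UNIV. M $ l $ i * h (word_exp w + unit_exp j + unit_exp l))" for i j w
  proof -
    have "polar h (M *v axis i 1 # axis j 1 # map (\<lambda>i. axis i 1) w) =
      (\<Sum>l\<in>UNIV. (M *v axis i 1) $ l * polar (\<lambda>\<alpha>. h (\<alpha> + unit_exp l)) (map (\<lambda>i. axis i 1) (j # w)))"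
      by simp
    also have "\<dots> = (\<Sum>l\<in>UNIV. M $ l $ i * h (word_exp (j # w) + unit_exp l))"
      unfolding polar_axis by (simp add: matrix_vector_axis)
    finally show ?thesis by (simp add: add_ac)
  qed
  have "polar h (M *v axis i 1 # axis j 1 # map (\<lambda>i. axis i 1) (exp_word \<alpha>)) =
      polar h (M *v axis j 1 # axis i 1 # map (\<lambda>i. axis i 1) (exp_word \<alpha>))"
    using assms polar_swap by metis
  then show "(\<Sum>l\<in>UNIV. M $ l $ i * h (\<alpha> + unit_exp j + unit_exp l)) =
     (\<Sum>l\<in>UNIV. M $ l $ j * h (\<alpha> + unit_exp i + unit_exp l))"
    by (simp only: * word_exp_exp_word)
qed

lemma self_adjoint_mat_power:
  assumes "self_adjoint h M"
  shows "self_adjoint h (mat_power M k)"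
proof (induction k)
  case 0
  show ?case by (rule self_adjointI) simp
next
  case (Suc k)
  show ?case
  proof (rule self_adjointI)
    fix v w vs
    have "polar h (mat_power M (Suc k) *v v # w # vs) = polar h (M *v (mat_power M k *v v) # w # vs)"
      by (simp only: mat_power_Suc matrix_vector_mul_assoc)
    also have "\<dots> = polar h (v # mat_power M k *v (M *v w) # vs)"
      by (simp only: polar_self_adjoint[OF assms] polar_self_adjoint[OF Suc.IH])
    finally show "polar h (mat_power M (Suc k) *v v # w # vs) = polar h (v # mat_power M (Suc k) *v w # vs)"
      by (simp only: mat_power_Suc_right matrix_vector_mul_assoc)
  qed
qed

text \<open>
  For a self-adjoint \<open>M\<close> the argument on which \<open>M\<close> acts does not matter, so this is again a symmetric form.
\<close>

fun twisted_polar :: "(('r::finite \<Rightarrow>\<^sub>0 nat) \<Rightarrow> 'a::comm_ring_1) \<Rightarrow> 'a ^ 'r ^ 'r \<Rightarrow> ('a ^ 'r) list \<Rightarrow> 'a" where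
  "twisted_polar h M [] = 0"
| "twisted_polar h M (v # vs) = polar h (M *v v # vs)"

lemma twisted_polar_mset:
  assumes "self_adjoint h M" and "mset vs = mset ws"
  shows "twisted_polar h M vs = twisted_polar h M ws"
proof (cases vs)
  case Nil
  then show ?thesis using assms(2) by simp
next
  case (Cons v vs')
  then obtain w ws' where ws: "ws = w # ws'" using assms(2) by (cases ws) auto
  show ?thesis
  proof (cases "v = w")
    case True
    then have "mset (M *v v # vs') = mset (M *v w # ws')" using assms(2) Cons ws by simp
    then show ?thesis using polar_mset[of "M *v v # vs'" "M *v w # ws'" h] Cons ws
      by (simp del: polar.simps)
  next
    case False
    then have "w \<in> set vs'" using assms(2) Cons ws
      by (metis list.set_intros(1) set_ConsD set_mset_mset)
    then obtain us where us: "mset vs' = mset (w # us)"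
      by (intro that[of "remove1 w vs'"]) simp
    then have us': "mset ws' = mset (v # us)" using assms(2) Cons ws by simp
    have "twisted_polar h M vs = polar h (M *v v # w # us)"
      using us polar_mset[of "M *v v # vs'" "M *v v # w # us" h] Cons
      by (simp del: polar.simps)
    also have "\<dots> = polar h (v # M *v w # us)" by (rule polar_self_adjoint[OF assms(1)])
    also have "\<dots> = polar h (M *v w # ws')"
      using us' polar_mset[of "v # M *v w # us" "M *v w # ws'" h] by (simp del: polar.simps)
    finally show ?thesis using ws by simp
  qed
qed

section \<open>Minors that annihilate a form\<close>

text \<open>
  The evaluation of an operator on a coefficient function. It is linear in the operator, whereas the
  sums over supports in \<open>act\<close> are awkward to add.
\<close>

definition pairing :: "('b \<Rightarrow>\<^sub>0 'a::comm_ring_1) \<Rightarrow> ('b \<Rightarrow> 'a) \<Rightarrow> 'a" where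
  "pairing D g = (\<Sum>\<beta>\<in>Poly_Mapping.keys D. Poly_Mapping.lookup D \<beta> * g \<beta>)"

lemma pairing_add: "pairing (D + D') g = pairing D g + pairing D' g"
  unfolding pairing_def by (rule setsum_keys_plus_distrib) (simp_all add: ring_distribs)

lemma pairing_0 [simp]: "pairing 0 g = 0"
  by (simp add: pairing_def)

lemma pairing_diff: "pairing (D - D') g = pairing D g - pairing D' g"
  using pairing_add[of "D - D'" D' g] by simp

lemma pairing_sum: "pairing (\<Sum>j\<in>J. D j) g = (\<Sum>j\<in>J. pairing (D j) g)"
  by (induction J rule: infinite_finite_induct) (simp_all add: pairing_add)

lemma pairing_single [simp]: "pairing (Poly_Mapping.single \<beta> c) g = c * g \<beta>"
  by (cases "c = 0") (simp_all add: pairing_def)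

lemma lookup_act:
  "Poly_Mapping.lookup (act D f) \<alpha> = pairing D (\<lambda>\<beta>. Poly_Mapping.lookup f (\<alpha> + \<beta>))"
proof -
  have "(\<Sum>\<alpha>'\<in>Poly_Mapping.keys f. Poly_Mapping.lookup
      (if \<forall>i. Poly_Mapping.lookup \<beta> i \<le> Poly_Mapping.lookup \<alpha>' i
       then Poly_Mapping.single (\<alpha>' - \<beta>) (Poly_Mapping.lookup D \<beta> * Poly_Mapping.lookup f \<alpha>') else 0) \<alpha>) =
    Poly_Mapping.lookup D \<beta> * Poly_Mapping.lookup f (\<alpha> + \<beta>)" for \<beta>
  proof -
    have *: "(\<forall>i. Poly_Mapping.lookup \<beta> i \<le> Poly_Mapping.lookup \<alpha>' i) \<and> \<alpha>' - \<beta> = \<alpha> \<longleftrightarrow> \<alpha>' = \<alpha> + \<beta>" for \<alpha>'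
      by (auto simp: poly_mapping_eq_iff fun_eq_iff lookup_add lookup_minus) (metis le_add_diff_inverse2)
    have "(\<Sum>\<alpha>'\<in>Poly_Mapping.keys f. Poly_Mapping.lookup
      (if \<forall>i. Poly_Mapping.lookup \<beta> i \<le> Poly_Mapping.lookup \<alpha>' i
       then Poly_Mapping.single (\<alpha>' - \<beta>) (Poly_Mapping.lookup D \<beta> * Poly_Mapping.lookup f \<alpha>') else 0) \<alpha>) =
      (\<Sum>\<alpha>'\<in>Poly_Mapping.keys f. if \<alpha>' = \<alpha> + \<beta> then Poly_Mapping.lookup D \<beta> * Poly_Mapping.lookup f \<alpha>' else 0)"
      using * by (intro sum.cong) (auto simp: lookup_single when_def)
    also have "\<dots> = Poly_Mapping.lookup D \<beta> * Poly_Mapping.lookup f (\<alpha> + \<beta>)"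
      by (simp add: in_keys_iff)
    finally show ?thesis .
  qed
  then show ?thesis unfolding act_def pairing_def lookup_sum by simp
qed

text \<open>
  The minor with indices \<open>i\<close>, \<open>j\<close> is \<open>\<partial>\<^sub>i(A\<partial>)\<^sub>j - \<partial>\<^sub>j(A\<partial>)\<^sub>i\<close>, and \<open>\<partial>\<^sub>j \<mapsto> (A\<partial>)\<^sub>j\<close> is the map with matrix
  \<open>transpose A\<close>. That the minor annihilates \<open>f\<close> is the self-adjointness condition for \<open>\<partial>\<^sub>i\<close> and \<open>\<partial>\<^sub>j\<close>.
\<close>

lemma M_set_self_adjoint:
  fixes f :: "('a::finite, 'b::field) dpow"
  assumes "A \<in> M_set f"
  shows "self_adjoint (Poly_Mapping.lookup f) (transpose A)"
  unfolding self_adjoint_def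
proof (intro allI)
  fix \<alpha> i j
  interpret R: module "(*) :: ('a, 'b) diffop \<Rightarrow> ('a, 'b) diffop \<Rightarrow> ('a, 'b) diffop"
    by unfold_locales (simp_all add: algebra_simps)
  show "(\<Sum>l\<in>UNIV. transpose A $ l $ i * Poly_Mapping.lookup f (\<alpha> + unit_exp j + unit_exp l)) =
        (\<Sum>l\<in>UNIV. transpose A $ l $ j * Poly_Mapping.lookup f (\<alpha> + unit_exp i + unit_exp l))"
  proof (cases "i = j")
    case False
    let ?u = "partial_vec :: ('a, 'b) diffop ^ 'a" and ?v = "mat_partial_vec A"
    have v: "?u $ i * ?v $ j = (\<Sum>l\<in>UNIV. Poly_Mapping.single (unit_exp i + unit_exp l) (A $ j $ l))" for i j
      by (simp add: mat_partial_vec_def matrix_vector_mult_def partial_vec_def const_op_def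
          sum_distrib_left mult_single)
    have "?u $ i * ?v $ j - ?u $ j * ?v $ i \<in> ideal_minors2 ?u ?v"
      unfolding ideal_minors2_def using False by (intro R.span_base) blast
    then have "act (?u $ i * ?v $ j - ?u $ j * ?v $ i) f = 0"
      using assms by (auto simp: M_set_def ann_def)
    then have "pairing (?u $ i * ?v $ j - ?u $ j * ?v $ i) (\<lambda>\<beta>. Poly_Mapping.lookup f (\<alpha> + \<beta>)) = 0"
      by (simp flip: lookup_act)
    then show ?thesis
      by (simp add: v pairing_diff pairing_sum add_ac transpose_def)
  qed simp
qed

section \<open>Change of scalars\<close>

definition map_vec :: "('a \<Rightarrow> 'b) \<Rightarrow> 'a ^ 'r \<Rightarrow> 'b ^ 'r" where
  "map_vec h v = (\<chi> i. h (v $ i))"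

lemma map_vec_nth [simp]: "map_vec h v $ i = h (v $ i)"
  by (simp add: map_vec_def)

locale ring_hom =
  fixes \<phi> :: "'a::comm_ring_1 \<Rightarrow> 'b::comm_ring_1"
  assumes add: "\<phi> (x + y) = \<phi> x + \<phi> y"
    and mult: "\<phi> (x * y) = \<phi> x * \<phi> y"
    and one [simp]: "\<phi> 1 = 1"
begin

lemma zero [simp]: "\<phi> 0 = 0"
  using add[of 0 0] by simp

lemma minus: "\<phi> (x - y) = \<phi> x - \<phi> y"
  using add[of "x - y" y] by (simp add: algebra_simps)

lemma sum: "\<phi> (\<Sum>j\<in>J. c j) = (\<Sum>j\<in>J. \<phi> (c j))"
  by (induction J rule: infinite_finite_induct) (simp_all add: add)

lemma prod_list: "\<phi> (prod_list xs) = prod_list (map \<phi> xs)"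
  by (induction xs) (simp_all add: mult)

lemma matrix_vec: "map_vec \<phi> (M *v v) = map_matrix \<phi> M *v map_vec \<phi> v"
  by (simp add: vec_eq_iff matrix_vector_mult_def sum mult)

lemma matrix_mul: "map_matrix \<phi> (M ** N) = map_matrix \<phi> M ** map_matrix \<phi> N"
  by (simp add: vec_eq_iff matrix_matrix_mult_def sum mult)

lemma matrix_sum: "map_matrix \<phi> (\<Sum>j\<in>J. M j) = (\<Sum>j\<in>J. map_matrix \<phi> (M j))"
  by (simp add: vec_eq_iff sum)

lemma mat_1: "map_matrix \<phi> (mat 1) = mat 1"
  by (simp add: vec_eq_iff mat_def)

lemma axis_1: "map_vec \<phi> (axis i 1) = axis i 1"
  by (simp add: vec_eq_iff axis_def)

lemma polar: "\<phi> (polar h vs) = polar (\<lambda>\<alpha>. \<phi> (h \<alpha>)) (map (map_vec \<phi>) vs)"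
  by (induction vs arbitrary: h) (simp_all add: sum mult)

lemma twisted_polar:
  "\<phi> (twisted_polar h M vs) = twisted_polar (\<lambda>\<alpha>. \<phi> (h \<alpha>)) (map_matrix \<phi> M) (map (map_vec \<phi>) vs)"
  by (cases vs) (simp_all add: polar matrix_vec del: polar.simps)

lemma self_adjoint:
  assumes "self_adjoint h M"
  shows "self_adjoint (\<lambda>\<alpha>. \<phi> (h \<alpha>)) (map_matrix \<phi> M)"
  using assms unfolding self_adjoint_def by (simp flip: sum mult)

end

lemma ring_hom_comp:
  assumes "ring_hom \<phi>" "ring_hom \<psi>"
  shows "ring_hom (\<lambda>x. \<psi> (\<phi> x))"
  using assms by (simp add: ring_hom_def)

section \<open>Newton interpolation\<close>

primrec newton :: "(nat \<Rightarrow> 'a::comm_ring_1) \<Rightarrow> nat \<Rightarrow> 'a \<Rightarrow> 'a" where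
  "newton s 0 x = 1"
| "newton s (Suc m) x = newton s m x * (x - s m)"

text \<open>
  The coefficient of the \<open>m\<close>-th Newton polynomial in the expansion of \<open>X\<^sup>k\<close>, which is the complete
  homogeneous symmetric polynomial of degree \<open>k - m\<close> in \<open>s\<^sub>0, \<dots>, s\<^sub>m\<close>. The recursion is
  \<open>X N\<^sub>m = N\<^sub>m\<^sub>+\<^sub>1 + s\<^sub>m N\<^sub>m\<close>.
\<close>

primrec power_newton_coeff :: "(nat \<Rightarrow> 'a::comm_ring_1) \<Rightarrow> nat \<Rightarrow> nat \<Rightarrow> 'a" where
  "power_newton_coeff s 0 m = (if m = 0 then 1 else 0)"
| "power_newton_coeff s (Suc k) m = (if m = 0 then 0 else power_newton_coeff s k (m - 1)) + s m * power_newton_coeff s k m"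

lemma newton_node_eq_0: "i < m \<Longrightarrow> newton s m (s i) = 0"
  by (induction m) (auto simp: less_Suc_eq)

lemma newton_node_neq_0:
  fixes s :: "nat \<Rightarrow> 'a::idom"
  assumes "inj_on s {..n}" "i \<le> n" "m \<le> i"
  shows "newton s m (s i) \<noteq> 0"
  using assms(3)
proof (induction m)
  case (Suc m)
  then have "s i \<noteq> s m" using assms(1,2) by (auto dest: inj_onD)
  then show ?case using Suc by simp
qed simp

text \<open>
  The expansion of \<open>X\<^sup>k\<close> in the Newton basis may be truncated at \<open>n\<close> when it is evaluated at one of
  the nodes \<open>s\<^sub>0, \<dots>, s\<^sub>n\<close>, since the remaining Newton polynomials vanish there.
\<close>

lemma power_node_newton:
  assumes "i \<le> n"
  shows "s i ^ k = (\<Sum>m\<le>n. power_newton_coeff s k m * newton s m (s i))"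
proof (induction k)
  case 0
  have "(\<Sum>m\<le>n. power_newton_coeff s 0 m * newton s m (s i)) = (\<Sum>m\<le>n. if m = 0 then 1 else 0)"
    by (intro sum.cong) auto
  then show ?case by simp
next
  case (Suc k)
  let ?N = "\<lambda>m. newton s m (s i)"
  have last: "?N n * (s i - s n) = 0"
    using newton_node_eq_0[of i "Suc n" s] assms by simp
  have "(\<Sum>m\<le>n. power_newton_coeff s (Suc k) m * ?N m) =
      (\<Sum>m\<le>n. (if m = 0 then 0 else power_newton_coeff s k (m - 1)) * ?N m) + (\<Sum>m\<le>n. s m * power_newton_coeff s k m * ?N m)"
    by (simp add: ring_distribs sum.distrib)
  also have "(\<Sum>m\<le>n. (if m = 0 then 0 else power_newton_coeff s k (m - 1)) * ?N m) = (\<Sum>m<n. power_newton_coeff s k m * (?N m * (s i - s m)))"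
    by (subst sum.atMost_shift) simp
  also have "\<dots> = (\<Sum>m\<le>n. power_newton_coeff s k m * (?N m * (s i - s m)))"
    using last by (simp flip: lessThan_Suc_atMost)
  also have "\<dots> + (\<Sum>m\<le>n. s m * power_newton_coeff s k m * ?N m) = (\<Sum>m\<le>n. s i * (power_newton_coeff s k m * ?N m))"
    by (simp add: algebra_simps flip: sum.distrib)
  also have "\<dots> = s i ^ Suc k" by (simp add: Suc.IH sum_distrib_left)
  finally show ?case ..
qed

definition newton_coeff :: "(nat \<Rightarrow> 'a::comm_ring_1) \<Rightarrow> nat \<Rightarrow> 'a poly \<Rightarrow> 'a" where
  "newton_coeff s m p = (\<Sum>k\<le>degree p. coeff p k * power_newton_coeff s k m)"

lemma newton_interpolation:
  assumes "i \<le> n"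
  shows "poly p (s i) = (\<Sum>m\<le>n. newton_coeff s m p * newton s m (s i))"
proof -
  have "poly p (s i) = (\<Sum>k\<le>degree p. \<Sum>m\<le>n. coeff p k * (power_newton_coeff s k m * newton s m (s i)))"
    unfolding poly_altdef power_node_newton[OF assms] by (simp add: sum_distrib_left)
  also have "\<dots> = (\<Sum>m\<le>n. newton_coeff s m p * newton s m (s i))"
    by (subst sum.swap) (simp add: newton_coeff_def sum_distrib_left mult_ac)
  finally show ?thesis .
qed

text \<open>
  The values at the nodes depend on the Newton coefficients through the triangular matrix
  \<open>N\<^sub>l(s\<^sub>i)\<close>, whose diagonal is invertible. The weights \<open>\<kappa> m i\<close> are those of the divided differences. It matters
  below that \<open>\<kappa> m i\<close> occurs only for \<open>i \<le> m\<close>.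
\<close>

lemma newton_coeffs_from_values:
  fixes s :: "nat \<Rightarrow> 'l::field"
  assumes "inj_on s {..n}"
  shows "\<exists>\<kappa>. \<forall>c. \<forall>m\<le>n. c m = (\<Sum>i\<le>m. \<kappa> m i * (\<Sum>l\<le>n. c l * newton s l (s i)))"
proof -
  have "\<exists>\<kappa>. \<forall>c. c m = (\<Sum>i\<le>m. \<kappa> i * (\<Sum>l\<le>n. c l * newton s l (s i)))" if "m \<le> n" for m
    using that
  proof (induction m rule: less_induct)
    case (less m)
    then have "\<forall>l. \<exists>\<kappa>. l < m \<longrightarrow> (\<forall>c. c l = (\<Sum>i\<le>l. \<kappa> i * (\<Sum>l\<le>n. c l * newton s l (s i))))"
      by (meson less_imp_le order_trans)
    then obtain \<kappa> where \<kappa>: "\<And>l c. l < m \<Longrightarrow> c l = (\<Sum>i\<le>l. \<kappa> l i * (\<Sum>l\<le>n. c l * newton s l (s i)))"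
      by metis
    define \<kappa>' where "\<kappa>' i = (if i = m then 1 else - (\<Sum>l\<in>{i..<m}. newton s l (s m) * \<kappa> l i)) / newton s m (s m)" for i
    have "c m = (\<Sum>i\<le>m. \<kappa>' i * (\<Sum>l\<le>n. c l * newton s l (s i)))" for c
    proof -
      define V where "V i = (\<Sum>l\<le>n. c l * newton s l (s i))" for i
      have nz: "newton s m (s m) \<noteq> 0" by (rule newton_node_neq_0[OF assms less.prems]) simp
      have "V m = (\<Sum>l\<le>m. c l * newton s l (s m))"
        unfolding V_def using less.prems by (intro sum.mono_neutral_right) (auto simp: newton_node_eq_0)
      also have "\<dots> = c m * newton s m (s m) + (\<Sum>l<m. c l * newton s l (s m))"
        by (simp add: add.commute flip: lessThan_Suc_atMost)
      also have "(\<Sum>l<m. c l * newton s l (s m)) = (\<Sum>l<m. \<Sum>i\<le>l. newton s l (s m) * \<kappa> l i * V i)"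
        using \<kappa>[of _ c, folded V_def]
        by (intro sum.cong refl) (simp add: sum_distrib_right sum_distrib_left mult_ac)
      also have "\<dots> = (\<Sum>i<m. \<Sum>l\<in>{i..<m}. newton s l (s m) * \<kappa> l i * V i)"
        unfolding sum.Sigma[OF finite_lessThan ballI, OF finite_atMost]
          sum.Sigma[OF finite_lessThan ballI, OF finite_atLeastLessThan]
        by (rule sum.reindex_bij_witness[of _ "\<lambda>(x, y). (y, x)" "\<lambda>(x, y). (y, x)"]) auto
      also have "\<dots> = (\<Sum>i<m. - (newton s m (s m) * \<kappa>' i * V i))"
        using nz by (intro sum.cong refl) (simp add: \<kappa>'_def sum_distrib_right)
      finally have "c m * newton s m (s m) = V m + (\<Sum>i<m. newton s m (s m) * \<kappa>' i * V i)"
        by (simp add: sum_negf)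
      also have "\<dots> = newton s m (s m) * (\<Sum>i\<le>m. \<kappa>' i * V i)"
        using nz by (simp add: \<kappa>'_def[of m] algebra_simps sum_distrib_left flip: lessThan_Suc_atMost)
      finally show ?thesis using nz unfolding V_def by simp
    qed
    then show ?case by blast
  qed
  then have "\<forall>m. \<exists>\<kappa>. m \<le> n \<longrightarrow> (\<forall>c. c m = (\<Sum>i\<le>m. \<kappa> i * (\<Sum>l\<le>n. c l * newton s l (s i))))"
    by blast
  then show ?thesis by metis
qed

context ring_hom
begin

lemma newton: "\<phi> (newton s m x) = newton (\<lambda>l. \<phi> (s l)) m (\<phi> x)"
  by (induction m) (simp_all add: mult minus)

lemma power_newton_coeff_at_0:
  assumes "\<And>l. \<phi> (s l) = 0"
  shows "\<phi> (power_newton_coeff s k m) = (if k = m then 1 else 0)"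
  using assms by (induction k arbitrary: m) (auto simp: add mult)

lemma newton_coeff_at_0:
  assumes "\<And>l. \<phi> (s l) = 0"
  shows "\<phi> (newton_coeff s m p) = \<phi> (coeff p m)"
proof -
  have "\<phi> (newton_coeff s m p) = (\<Sum>k\<le>degree p. if k = m then \<phi> (coeff p k) else 0)"
    unfolding newton_coeff_def sum mult power_newton_coeff_at_0[of s, OF assms] by (intro sum.cong) auto
  then show ?thesis by (simp add: coeff_eq_0)
qed

lemma ring_hom_map_poly: "ring_hom (map_poly \<phi>)"
proof
  show "map_poly \<phi> (p + q) = map_poly \<phi> p + map_poly \<phi> q" for p q
    by (simp add: poly_eq_iff coeff_map_poly add)
  show "map_poly \<phi> (p * q) = map_poly \<phi> p * map_poly \<phi> q" for p q
    by (simp add: poly_eq_iff coeff_map_poly coeff_mult sum mult)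
  show "map_poly \<phi> 1 = 1"
    by (simp add: poly_eq_iff coeff_map_poly)
qed

lemma ring_hom_poly: "ring_hom (\<lambda>p. \<phi> (poly p x))"
  by unfold_locales (simp_all add: add mult)

end

section \<open>Eigenspaces of the deformed endomorphism\<close>

definition weighted_sum :: "nat \<Rightarrow> (nat \<Rightarrow> 'a::comm_ring_1) \<Rightarrow> (nat \<Rightarrow> 'a ^ 'r ^ 'm) \<Rightarrow> 'a ^ 'r ^ 'm" where
  "weighted_sum n c C = (\<chi> p q. \<Sum>j\<le>n. c j * C j $ p $ q)"

lemma weighted_sum_vec: "weighted_sum n c C *v v = (\<Sum>j\<le>n. c j *s (C j *v v))"
  by (simp add: vec_eq_iff weighted_sum_def matrix_vector_mult_def sum_distrib_left sum_distrib_right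
      mult.assoc) (subst sum.swap, simp)

lemma (in ring_hom) weighted_sum:
  "map_matrix \<phi> (weighted_sum n c C) = weighted_sum n (\<lambda>j. \<phi> (c j)) (\<lambda>j. map_matrix \<phi> (C j))"
  by (simp add: vec_eq_iff weighted_sum_def sum mult)

text \<open>
  The properties of \<open>chain_system\<close> with the projection \<open>E = 1\<close>, for the family \<open>T m\<close> of powers of a nilpotent
  matrix. They are equations between matrices and hence survive a change of scalars.
\<close>

definition chain_frame :: "(nat \<Rightarrow> 'a::comm_ring_1 ^ 'r ^ 'r) \<Rightarrow> nat \<Rightarrow> (nat \<Rightarrow> 'a ^ 'r ^ 'r::finite) \<Rightarrow> bool" where
  "chain_frame T n C \<longleftrightarrow>
     T 0 = mat 1 \<and> (\<forall>i j. T (i + j) = T i ** T j) \<and> T (Suc n) = 0 \<and>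
     (\<forall>j. C 0 ** C j = C j) \<and> (\<forall>i j. i \<noteq> j \<longrightarrow> C i ** T j ** C 0 = 0) \<and>
     (\<Sum>j\<le>n. T j ** C j) = mat 1"

lemma (in ring_hom) chain_frame:
  assumes "chain_frame T n C"
  shows "chain_frame (\<lambda>m. map_matrix \<phi> (T m)) n (\<lambda>j. map_matrix \<phi> (C j))"
proof -
  have "map_matrix \<phi> 0 = 0" by (simp add: vec_eq_iff)
  then show ?thesis
    using assms unfolding chain_frame_def
    by (auto simp: mat_1 simp flip: matrix_mul matrix_sum)
qed

lemma chain_frame_mult_C0:
  assumes "chain_frame T n C" "j \<le> n"
  shows "T j ** C j ** T j ** C 0 = T j ** C 0"
proof -
  have "T j ** C 0 = (\<Sum>l\<le>n. T l ** C l) ** (T j ** C 0)"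
    using assms by (simp add: chain_frame_def)
  also have "\<dots> = (\<Sum>l\<le>n. T l ** (C l ** T j ** C 0))"
    by (simp add: matrix_eq matrix_vector_mul_assoc[symmetric] matrix_vector_sum_left)
  also have "\<dots> = (\<Sum>l\<le>n. if l = j then T j ** (C j ** T j ** C 0) else 0)"
    using assms by (intro sum.cong) (auto simp: chain_frame_def)
  also have "\<dots> = T j ** (C j ** T j ** C 0)" using assms(2) by simp
  finally show ?thesis by (simp add: matrix_mul_assoc)
qed

text \<open>
  In the deformed module the chain of \<open>e\<close> becomes \<open>N\<^sub>0(X)e, N\<^sub>1(X)e, \<dots>\<close>, and this map is evaluation of \<open>X\<close>
  at the \<open>i\<close>-th node: it sends the \<open>j\<close>-th vector of the chain to \<open>N\<^sub>j(s\<^sub>i)e\<close>.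
\<close>

definition eigenspace_map :: "(nat \<Rightarrow> 'a::comm_ring_1) \<Rightarrow> nat \<Rightarrow> (nat \<Rightarrow> 'a ^ 'r ^ 'r) \<Rightarrow> nat \<Rightarrow> 'a ^ 'r ^ 'r" where
  "eigenspace_map s n C i = weighted_sum n (\<lambda>j. newton s j (s i)) C"

lemma eigenspace_map_chain:
  assumes "chain_frame T n C" "j \<le> n"
  shows "eigenspace_map s n C i *v (T j *v (C 0 *v u)) = newton s j (s i) *s (C j *v (T j *v (C 0 *v u)))"
proof -
  have "C l *v (T j *v (C 0 *v u)) = 0" if "l \<noteq> j" for l
    using assms that by (simp add: chain_frame_def matrix_vector_mul_assoc matrix_mul_assoc)
  then have "eigenspace_map s n C i *v (T j *v (C 0 *v u)) =
      (\<Sum>l\<le>n. if l = j then newton s j (s i) *s (C j *v (T j *v (C 0 *v u))) else 0)"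
    unfolding eigenspace_map_def weighted_sum_vec by (intro sum.cong) auto
  then show ?thesis using assms(2) by simp
qed

lemma (in ring_hom) eigenspace_map:
  "map_matrix \<phi> (eigenspace_map s n C i) = eigenspace_map (\<lambda>l. \<phi> (s l)) n (\<lambda>j. map_matrix \<phi> (C j)) i"
  by (simp add: eigenspace_map_def weighted_sum newton)

text \<open>
  Only the chains with more than \<open>i\<close> vectors have an eigenvector for \<open>s\<^sub>i\<close>; composing with \<open>T i\<close> removes the
  generators of the shorter ones. Inserting the vectors \<open>T\<^sup>ju\<close> with \<open>u\<close> in the span of the generators turns the hypothesis into
  a linear system with the matrix \<open>N\<^sub>j(s\<^sub>l)\<close>, which vanishes for \<open>l < j\<close> and is non-zero for \<open>l = j\<close>. The
  system is solved from the last unknown downwards.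
\<close>

lemma eigenspaces_independent:
  fixes T C :: "nat \<Rightarrow> 'l::field ^ 'r ^ 'r::finite"
  assumes frame: "chain_frame T n C" and inj: "inj_on s {..n}"
    and zero: "\<And>v. (\<Sum>i\<le>n. dotv (a i) (T i *v (eigenspace_map s n C i *v v))) = 0"
    and "i \<le> n"
  shows "dotv (a i) (T i *v (eigenspace_map s n C i *v v)) = 0"
proof -
  have Tadd: "T (i + j) = T i ** T j" for i j using frame by (simp add: chain_frame_def)
  have "dotv (a i) (T i *v (C 0 *v u)) = 0" if "i \<le> n" for u
    using that
  proof (induction "n - i" arbitrary: i rule: less_induct)
    case less
    have "T l *v (C i *v (T i *v (C 0 *v u))) = T l *v (C 0 *v u)" if "i \<le> l" for l
    proof -
      have "T l = T (l - i) ** T i" using that by (metis Tadd le_add_diff_inverse2)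
      then have "T l *v (C i *v (T i *v (C 0 *v u))) = T (l - i) *v ((T i ** C i ** T i ** C 0) *v u)"
        by (simp add: matrix_vector_mul_assoc matrix_mul_assoc)
      also have "\<dots> = T l *v (C 0 *v u)"
        using \<open>T l = T (l - i) ** T i\<close> chain_frame_mult_C0[OF frame less.prems]
        by (simp add: matrix_vector_mul_assoc matrix_mul_assoc)
      finally show ?thesis .
    qed
    then have "dotv (a l) (T l *v (eigenspace_map s n C l *v (T i *v (C 0 *v u)))) =
        newton s i (s l) * dotv (a l) (T l *v (C 0 *v u))" for l
      unfolding eigenspace_map_chain[OF frame less.prems]
      by (cases "i \<le> l") (simp_all add: matrix_vector_scale dotv_right_scale newton_node_eq_0)
    then have "0 = (\<Sum>l\<le>n. newton s i (s l) * dotv (a l) (T l *v (C 0 *v u)))"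
      using zero[of "T i *v (C 0 *v u)"] by simp
    also have "\<dots> = (\<Sum>l\<le>n. if l = i then newton s i (s i) * dotv (a i) (T i *v (C 0 *v u)) else 0)"
    proof (rule sum.cong)
      fix l assume "l \<in> {..n}"
      then show "newton s i (s l) * dotv (a l) (T l *v (C 0 *v u)) =
          (if l = i then newton s i (s i) * dotv (a i) (T i *v (C 0 *v u)) else 0)"
        using less.hyps[of l] less.prems
        by (cases l i rule: linorder_cases) (auto simp: newton_node_eq_0)
    qed simp
    also have "\<dots> = newton s i (s i) * dotv (a i) (T i *v (C 0 *v u))" using less.prems by simp
    finally show ?case using newton_node_neq_0[OF inj less.prems order_refl] by simp
  qed
  note * = this[OF \<open>i \<le> n\<close>]
  have "C j *v v = C 0 *v (C j *v v)" for j
    using frame by (simp add: chain_frame_def matrix_vector_mul_assoc)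
  then have "dotv (a i) (T i *v (C j *v v)) = 0" for j using * by metis
  then show ?thesis
    by (simp add: eigenspace_map_def weighted_sum_vec matrix_vector_sum_right dotv_right_sum
        matrix_vector_scale dotv_right_scale)
qed

section \<open>The specialization of the deformed form\<close>

lemma ring_hom_const_poly: "ring_hom (\<lambda>x. [:x:])"
  by unfold_locales simp_all

text \<open>
  Let \<open>\<Psi>(p\<^sub>1, \<dots>, p\<^sub>d)\<close> be the sum over \<open>m \<le> n\<close> of the \<open>X\<^sup>m\<close>-coefficients of
  \<open>F(T\<^sup>mp\<^sub>1, p\<^sub>2, \<dots>, p\<^sub>d)\<close>, for vectors \<open>p\<^sub>i\<close> of polynomials. Multiplying an argument by \<open>X\<close> shifts the
  coefficients by one, which has the same effect as applying \<open>T\<close>, because \<open>T\<^sup>n\<^sup>+\<^sup>1 = 0\<close>. Hence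
  \<open>\<Sum>\<^sub>j X\<^sup>jC\<^sub>jv\<close> may be replaced by \<open>\<Sum>\<^sub>j T\<^sup>jC\<^sub>jv = v\<close> in each argument, and on constant
  vectors \<open>\<Psi>\<close> is the polarization.
\<close>

lemma truncated_polar_eq_polar:
  fixes h :: "('r::finite \<Rightarrow>\<^sub>0 nat) \<Rightarrow> 'k::comm_ring_1"
  defines "c \<equiv> (\<lambda>x::'k. [:x:])"
  assumes frame: "chain_frame T n C" and sa: "\<And>m. self_adjoint h (T m)" and "vs \<noteq> []"
  shows "(\<Sum>m\<le>n. coeff (twisted_polar (\<lambda>\<alpha>. c (h \<alpha>)) (map_matrix c (T m))
            (map (\<lambda>v. weighted_sum n (\<lambda>j. monom 1 j) (\<lambda>j. map_matrix c (C j)) *v map_vec c v) vs)) m) = polar h vs"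
proof -
  interpret c: ring_hom c unfolding c_def by (rule ring_hom_const_poly)
  let ?h = "\<lambda>\<alpha>. c (h \<alpha>)" and ?T = "\<lambda>m. map_matrix c (T m)" and ?C = "\<lambda>m. map_matrix c (C m)"
  let ?Q = "weighted_sum n (\<lambda>j. monom 1 j) ?C"
  define \<Psi> where "\<Psi> ps = (\<Sum>m\<le>n. coeff (twisted_polar ?h (?T m) ps) m)" for ps
  have frame': "chain_frame ?T n ?C" by (rule c.chain_frame[OF frame])
  have sa': "self_adjoint ?h (?T m)" for m by (rule c.self_adjoint[OF sa])
  have perm: "mset ps = mset qs \<Longrightarrow> \<Psi> ps = \<Psi> qs" for ps qs
    unfolding \<Psi>_def using twisted_polar_mset[OF sa'] by metis
  have \<Psi>_sum: "\<Psi> ((\<Sum>j\<in>J. v j) # ps) = (\<Sum>j\<in>J. \<Psi> (v j # ps))" for J :: "nat set" and v ps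
    unfolding \<Psi>_def twisted_polar.simps matrix_vector_sum_right polar_sum coeff_sum by (rule sum.swap)
  have shift1: "\<Psi> ((monom 1 1 *s p) # ps) = \<Psi> ((?T 1 *v p) # ps)" for p ps
  proof -
    let ?t = "\<lambda>m. polar ?h (?T m *v p # ps)"
    have "\<Psi> ((monom 1 1 *s p) # ps) = (\<Sum>m\<le>n. coeff (monom 1 1 * ?t m) m)"
      by (simp only: \<Psi>_def twisted_polar.simps matrix_vector_scale polar_scale)
    also have "\<dots> = (\<Sum>m<n. coeff (?t (Suc m)) m)"
      unfolding coeff_monom_mult by (subst sum.atMost_shift) (simp del: polar.simps)
    also have "\<dots> = (\<Sum>m\<le>n. coeff (?t (Suc m)) m)"
      using frame' by (simp add: chain_frame_def polar_0 flip: lessThan_Suc_atMost)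
    also have "\<dots> = \<Psi> ((?T 1 *v p) # ps)"
    proof -
      have "?T (Suc m) = ?T m ** ?T 1" for m
        using frame' unfolding chain_frame_def by (metis Suc_eq_plus1)
      then show ?thesis by (simp only: \<Psi>_def twisted_polar.simps matrix_vector_mul_assoc)
    qed
    finally show ?thesis .
  qed
  have shift: "\<Psi> ((monom 1 j *s p) # ps) = \<Psi> ((?T j *v p) # ps)" for j p ps
  proof (induction j arbitrary: p)
    case 0
    then show ?case using frame' by (simp add: chain_frame_def monom_0 flip: one_pCons)
  next
    case (Suc j)
    have "monom 1 (Suc j) *s p = monom 1 1 *s (monom 1 j *s p)"
      by (simp add: vector_smult_assoc mult_monom)
    then have "\<Psi> ((monom 1 (Suc j) *s p) # ps) = \<Psi> ((monom 1 j *s (?T 1 *v p)) # ps)"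
      by (simp only: shift1 matrix_vector_scale)
    also have "\<dots> = \<Psi> ((?T (Suc j) *v p) # ps)"
    proof -
      have "?T (Suc j) = ?T j ** ?T 1"
        using frame' unfolding chain_frame_def by (metis Suc_eq_plus1)
      then show ?thesis by (simp only: Suc.IH matrix_vector_mul_assoc)
    qed
    finally show ?case .
  qed
  have head: "\<Psi> ((?Q *v p) # ps) = \<Psi> (p # ps)" for p ps
  proof -
    have "\<Psi> ((?Q *v p) # ps) = (\<Sum>j\<le>n. \<Psi> ((?T j *v (?C j *v p)) # ps))"
      unfolding weighted_sum_vec \<Psi>_sum shift ..
    also have "\<dots> = \<Psi> (((\<Sum>j\<le>n. ?T j ** ?C j) *v p) # ps)"
      unfolding matrix_vector_sum_left \<Psi>_sum matrix_vector_mul_assoc ..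
    also have "(\<Sum>j\<le>n. ?T j ** ?C j) = mat 1" using frame' by (simp add: chain_frame_def)
    finally show ?thesis by simp
  qed
  have "\<Psi> (map (\<lambda>v. ?Q *v map_vec c v) us @ ps) = \<Psi> (map (map_vec c) us @ ps)" for us ps
  proof (induction us arbitrary: ps)
    case (Cons u us)
    have "\<Psi> (map (\<lambda>v. ?Q *v map_vec c v) (u # us) @ ps) =
        \<Psi> (map_vec c u # (map (\<lambda>v. ?Q *v map_vec c v) us @ ps))"
      by (simp only: list.map append_Cons head)
    also have "\<dots> = \<Psi> (map (\<lambda>v. ?Q *v map_vec c v) us @ (map_vec c u # ps))"
      by (rule perm) simp
    also have "\<dots> = \<Psi> (map (map_vec c) (u # us) @ ps)"
      unfolding Cons.IH by (rule perm) simp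
    finally show ?case .
  qed simp
  from this[of vs "[]"]
  have "\<Psi> (map (\<lambda>v. ?Q *v map_vec c v) vs) = \<Psi> (map (map_vec c) vs)" by simp
  also have "\<dots> = (\<Sum>m\<le>n. if m = 0 then twisted_polar h (T 0) vs else 0)"
    unfolding \<Psi>_def by (intro sum.cong) (auto simp: c_def coeff_pCons simp flip: c.twisted_polar[unfolded c_def] split: nat.splits)
  also have "\<dots> = polar h vs"
    using \<open>vs \<noteq> []\<close> frame by (cases vs) (simp_all add: chain_frame_def)
  finally show ?thesis by (simp add: \<Psi>_def)
qed

section \<open>Forms that factor through one eigenspace\<close>

text \<open>
  Every derivative of \<open>g\<close> of the order that leaves a linear form has coefficients \<open>\<nu>(T\<^sup>iQ(s\<^sub>i)\<partial>\<^sub>l)\<close> for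
  some functional \<open>\<nu>\<close>, that is, it lies in the dual of the \<open>i\<close>-th eigenspace. Testing the derivatives by
  monomials is sufficient, as the condition is linear.
\<close>

definition component_form ::
  "(nat \<Rightarrow> 'a::comm_ring_1) \<Rightarrow> nat \<Rightarrow> (nat \<Rightarrow> 'a ^ 'r ^ 'r) \<Rightarrow> (nat \<Rightarrow> 'a ^ 'r ^ 'r) \<Rightarrow> nat \<Rightarrow>
    (('r::finite \<Rightarrow>\<^sub>0 nat) \<Rightarrow> 'a) \<Rightarrow> bool" where
  "component_form s n T C i g \<longleftrightarrow>
    (\<forall>\<beta>. \<exists>a. \<forall>l. g (\<beta> + unit_exp l) = dotv a (T i *v (eigenspace_map s n C i *v axis l 1)))"

lemma component_form_0: "component_form s n T C i (\<lambda>_. 0)"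
  unfolding component_form_def by (metis dotv_left_0)

lemma component_form_add:
  assumes "component_form s n T C i g" "component_form s n T C i g'"
  shows "component_form s n T C i (\<lambda>\<alpha>. g \<alpha> + g' \<alpha>)"
  using assms unfolding component_form_def by (metis dotv_left_add)

lemma component_form_scale:
  assumes "component_form s n T C i g"
  shows "component_form s n T C i (\<lambda>\<alpha>. c * g \<alpha>)"
  using assms unfolding component_form_def by (metis dotv_left_scale)

lemma component_form_sum:
  assumes "\<And>m. m \<in> M \<Longrightarrow> component_form s n T C i (g m)"
  shows "component_form s n T C i (\<lambda>\<alpha>. \<Sum>m\<in>M. g m \<alpha>)"
  using assms
  by (induction M rule: infinite_finite_induct) (simp_all add: component_form_0 component_form_add)

text \<open>
  By symmetry the matrix \<open>T m\<close> may be moved to the argument that is left after differentiation, and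
  \<open>T m = T (m - i) ** T i\<close>.
\<close>

lemma component_form_twisted_polar:
  assumes frame: "chain_frame T n C" and sa: "self_adjoint h (T m)" and "i \<le> m"
  shows "component_form s n T C i
    (\<lambda>\<alpha>. twisted_polar h (T m) (map (\<lambda>l. eigenspace_map s n C i *v axis l 1) (exp_word \<alpha>)))"
  unfolding component_form_def
proof
  fix \<beta>
  let ?Q = "\<lambda>l. eigenspace_map s n C i *v axis l 1"
  from frame \<open>i \<le> m\<close> have T: "T m = T (m - i) ** T i"
    unfolding chain_frame_def by (metis le_add_diff_inverse2)
  obtain a where a: "\<And>v. polar h (T (m - i) *v v # map ?Q (exp_word \<beta>)) = dotv a v"
    using polar_matrix by blast
  have "twisted_polar h (T m) (map ?Q (exp_word (\<beta> + unit_exp l))) = dotv a (T i *v ?Q l)" for l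
  proof -
    have "twisted_polar h (T m) (map ?Q (exp_word (\<beta> + unit_exp l))) =
        twisted_polar h (T m) (map ?Q (l # exp_word \<beta>))"
      by (rule twisted_polar_mset[OF sa]) (simp only: mset_map mset_exp_word_add_unit)
    also have "\<dots> = dotv a (T i *v ?Q l)"
      by (simp only: list.map twisted_polar.simps T matrix_vector_mul_assoc[symmetric] a)
    finally show ?thesis .
  qed
  then show "\<exists>a. \<forall>l. twisted_polar h (T m) (map ?Q (exp_word (\<beta> + unit_exp l))) = dotv a (T i *v ?Q l)"
    by blast
qed

text \<open>
  The coefficients of the divided power \<open>\<lambda>\<^sup>(\<^sup>d\<^sup>)\<close> of a linear form are products of coefficients of
  \<open>\<lambda>\<close>. Here \<open>\<lambda>\<close> is a row of \<open>T\<^sup>iQ(s\<^sub>i)\<close>.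
\<close>

lemma component_form_power:
  "component_form s n T C i (\<lambda>\<alpha>. \<Prod>l\<leftarrow>exp_word \<alpha>. (T i ** eigenspace_map s n C i) $ p $ l)"
  unfolding component_form_def
proof
  fix \<beta>
  let ?M = "T i ** eigenspace_map s n C i"
  have "(\<Prod>l\<leftarrow>exp_word (\<beta> + unit_exp k). ?M $ p $ l) =
      dotv (axis p (\<Prod>l\<leftarrow>exp_word \<beta>. ?M $ p $ l)) (T i *v (eigenspace_map s n C i *v axis k 1))" for k
  proof -
    have "(\<Prod>l\<leftarrow>exp_word (\<beta> + unit_exp k). ?M $ p $ l) =
        prod_mset (image_mset (\<lambda>l. ?M $ p $ l) (mset (exp_word (\<beta> + unit_exp k))))"
      by (simp flip: prod_mset_prod_list)
    also have "\<dots> = ?M $ p $ k * (\<Prod>l\<leftarrow>exp_word \<beta>. ?M $ p $ l)"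
      unfolding mset_exp_word_add_unit by (simp flip: prod_mset_prod_list)
    finally have 1: "(\<Prod>l\<leftarrow>exp_word (\<beta> + unit_exp k). ?M $ p $ l) = \<dots>" .
    have "dotv (axis p c) v = c * v $ p" for c and v :: "'a ^ 'b"
      unfolding dotv_def by (subst sum.remove[of _ p]) (auto simp: axis_def intro!: sum.neutral)
    then show ?thesis using 1
      by (simp add: matrix_vector_mul_assoc matrix_vector_axis mult.commute)
  qed
  then show "\<exists>a. \<forall>k. (\<Prod>l\<leftarrow>exp_word (\<beta> + unit_exp k). ?M $ p $ l) =
      dotv a (T i *v (eigenspace_map s n C i *v axis k 1))" by blast
qed

text \<open>
  If \<open>T\<^sup>i\<close> kills all generators, it kills all chains.
\<close>

lemma chain_frame_nonzero:
  fixes T C :: "nat \<Rightarrow> 'a::comm_ring_1 ^ 'r ^ 'r::finite"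
  assumes frame: "chain_frame T n C" and "T n \<noteq> 0" "i \<le> n"
  shows "T i ** C 0 \<noteq> 0"
proof
  assume 0: "T i ** C 0 = 0"
  have Tadd: "T (i + j) = T i ** T j" for i j using frame by (simp add: chain_frame_def)
  have "T i = T i ** (\<Sum>j\<le>n. T j ** C j)" using frame by (simp add: chain_frame_def)
  also have "\<dots> = (\<Sum>j\<le>n. T i ** (T j ** C j))"
    by (simp add: matrix_eq matrix_vector_mul_assoc[symmetric] matrix_vector_sum_left matrix_vector_sum_right)
  also have "\<dots> = 0"
  proof (rule sum.neutral, rule ballI)
    fix j
    have "T i ** (T j ** C j) = T (j + i) ** C j"
      by (simp add: matrix_mul_assoc add.commute flip: Tadd)
    also have "\<dots> = T j ** (T i ** (C 0 ** C j))"
      using frame by (simp add: Tadd matrix_mul_assoc[symmetric] chain_frame_def)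
    also have "\<dots> = 0" using 0 by (simp add: matrix_mul_assoc[of "T i"])
    finally show "T i ** (T j ** C j) = 0" .
  qed
  finally have "T i = 0" .
  moreover have "T n = T (n - i) ** T i" using Tadd \<open>i \<le> n\<close> by (metis le_add_diff_inverse2)
  ultimately show False using \<open>T n \<noteq> 0\<close> by simp
qed

text \<open>
  The eigenspace map is the identity on the generators, because \<open>N\<^sub>0 = 1\<close>.
\<close>

lemma eigenspace_map_nonzero:
  assumes frame: "chain_frame T n C" and "T i ** C 0 \<noteq> 0"
  shows "T i ** eigenspace_map s n C i \<noteq> 0"
proof
  assume 0: "T i ** eigenspace_map s n C i = 0"
  have "(T i ** C 0) *v u = 0" for u
  proof -
    have "C 0 *v (C 0 *v u) = C 0 *v u" "T 0 *v w = w" for w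
      using frame by (simp_all add: chain_frame_def matrix_vector_mul_assoc)
    with eigenspace_map_chain[OF frame, of 0 s i u]
    have "eigenspace_map s n C i *v (C 0 *v u) = C 0 *v u" by simp
    then show ?thesis using 0
      by (metis matrix_vector_mul_assoc matrix_vector_mult_0)
  qed
  with assms(2) show False by (simp add: matrix_eq)
qed

section \<open>The deformed form\<close>

text \<open>
  Here \<open>\<iota>\<close> stands for the inclusion of \<open>K\<close> into \<open>K[t]\<close>, \<open>\<epsilon>\<close> for the evaluation at \<open>t = 0\<close> and \<open>\<phi>\<close> for
  the inclusion of \<open>K[t]\<close> into its field of fractions. The function \<open>F\<close> gives the coefficients of the deformed
  form, and \<open>G i\<close> those of its component on the \<open>i\<close>-th eigenspace.
\<close>

lemma splitting_family:
  fixes h :: "('r::finite \<Rightarrow>\<^sub>0 nat) \<Rightarrow> 'k::comm_ring_1"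
    and \<iota> :: "'k \<Rightarrow> 'p::idom" and \<epsilon> :: "'p \<Rightarrow> 'k" and \<phi> :: "'p \<Rightarrow> 'l::field"
    and s :: "nat \<Rightarrow> 'p"
  assumes "ring_hom \<iota>" "ring_hom \<epsilon>" "ring_hom \<phi>"
    and \<epsilon>\<iota>: "\<And>x. \<epsilon> (\<iota> x) = x" and inj_\<phi>: "inj \<phi>"
    and s0: "\<And>l. \<epsilon> (s l) = 0" and inj_s: "inj_on s {..n}"
    and \<tau>: "\<epsilon> \<tau> = 0" "\<tau> \<noteq> 0"
    and frame: "chain_frame T n C" and "T n \<noteq> 0"
    and sa: "\<And>m. self_adjoint h (T m)"
    and "d \<ge> 1"
  defines "TL \<equiv> \<lambda>m. map_matrix (\<lambda>x. \<phi> (\<iota> x)) (T m)" and "CL \<equiv> \<lambda>m. map_matrix (\<lambda>x. \<phi> (\<iota> x)) (C m)"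
  shows "\<exists>F G. (\<forall>\<alpha>. mdeg \<alpha> = d \<longrightarrow> \<epsilon> (F \<alpha>) = h \<alpha> \<and> \<phi> (F \<alpha>) = (\<Sum>i\<le>n. G i \<alpha>)) \<and>
           (\<forall>i\<le>n. (\<exists>\<alpha>. mdeg \<alpha> = d \<and> G i \<alpha> \<noteq> 0) \<and> component_form (\<lambda>l. \<phi> (s l)) n TL CL i (G i))"
proof -
  interpret \<iota>: ring_hom \<iota> by fact
  interpret \<epsilon>: ring_hom \<epsilon> by fact
  interpret \<phi>: ring_hom \<phi> by fact
  interpret \<phi>\<iota>: ring_hom "\<lambda>x. \<phi> (\<iota> x)" by (rule ring_hom_comp) unfold_locales
  define c where "c x = [:\<iota> x:]" for x
  interpret c: ring_hom c
    using ring_hom_comp[OF \<iota>.ring_hom_axioms ring_hom_const_poly] by (simp add: c_def[abs_def])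
  let ?\<sigma> = "\<lambda>l. \<phi> (s l)"
  let ?hL = "\<lambda>\<alpha>. \<phi> (\<iota> (h \<alpha>))"
  have inj_\<sigma>: "inj_on ?\<sigma> {..n}"
    using inj_s inj_\<phi> by (auto simp: inj_on_def)
  have frameL: "chain_frame TL n CL" unfolding TL_def CL_def by (rule \<phi>\<iota>.chain_frame[OF frame])
  have saL: "self_adjoint ?hL (TL m)" for m unfolding TL_def by (rule \<phi>\<iota>.self_adjoint[OF sa])
  have frameP: "chain_frame (\<lambda>m. map_matrix \<iota> (T m)) n (\<lambda>m. map_matrix \<iota> (C m))"
    by (rule \<iota>.chain_frame[OF frame])

  \<comment> \<open>the Newton polynomials as elements of \<open>K[t][X]\<close>; \<open>[:0, 1:]\<close> is \<open>X\<close>\<close>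
  define Q where "Q = weighted_sum n (\<lambda>j. newton (\<lambda>l. [:s l:]) j [:0, 1:]) (\<lambda>j. map_matrix c (C j))"
  define P where "P m \<alpha> = twisted_polar (\<lambda>\<alpha>. c (h \<alpha>)) (map_matrix c (T m))
      (map (\<lambda>l. Q *v axis l 1) (exp_word \<alpha>))" for m \<alpha>
  define F0 where "F0 \<alpha> = (\<Sum>m\<le>n. newton_coeff s m (P m \<alpha>))" for \<alpha>

  have F0_special: "\<epsilon> (F0 \<alpha>) = h \<alpha>" if "mdeg \<alpha> = d" for \<alpha>
  proof -
    interpret E: ring_hom "map_poly \<epsilon>" by (rule \<epsilon>.ring_hom_map_poly)
    have Ec: "map_poly \<epsilon> (c x) = [:x:]" for x by (simp add: c_def map_poly_pCons \<epsilon>\<iota>)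
    have N: "newton (\<lambda>l. map_poly \<epsilon> [:s l:]) j (map_poly \<epsilon> [:0, 1:]) = monom 1 j" for j
      by (induction j) (simp_all add: map_poly_pCons s0 monom_0 monom_Suc flip: one_pCons)
    have Q0: "map_matrix (map_poly \<epsilon>) Q =
        weighted_sum n (\<lambda>j. monom 1 j) (\<lambda>j. map_matrix (\<lambda>x. [:x:]) (C j))"
    proof -
      have "map_matrix (map_poly \<epsilon>) (map_matrix c (C j)) = map_matrix (\<lambda>x. [:x:]) (C j)" for j
        by (simp add: vec_eq_iff Ec)
      then show ?thesis by (simp add: Q_def E.weighted_sum E.newton N)
    qed
    have P0: "map_poly \<epsilon> (P m \<alpha>) = twisted_polar (\<lambda>\<alpha>. [:h \<alpha>:]) (map_matrix (\<lambda>x. [:x:]) (T m))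
        (map (\<lambda>v. weighted_sum n (\<lambda>j. monom 1 j) (\<lambda>j. map_matrix (\<lambda>x. [:x:]) (C j)) *v
           map_vec (\<lambda>x. [:x:]) v) (map (\<lambda>l. axis l 1) (exp_word \<alpha>)))" for m
    proof -
      have "map_matrix (map_poly \<epsilon>) (map_matrix c (T m)) = map_matrix (\<lambda>x. [:x:]) (T m)"
        by (simp add: vec_eq_iff Ec)
      then show ?thesis
        by (simp add: P_def E.twisted_polar Ec comp_def E.matrix_vec Q0 E.axis_1
            ring_hom.axis_1[OF ring_hom_const_poly])
    qed
    have "\<epsilon> (F0 \<alpha>) = (\<Sum>m\<le>n. coeff (map_poly \<epsilon> (P m \<alpha>)) m)"
      by (simp add: F0_def \<epsilon>.sum \<epsilon>.newton_coeff_at_0 s0 coeff_map_poly)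
    also have "\<dots> = polar h (map (\<lambda>l. axis l 1) (exp_word \<alpha>))"
    proof -
      have "exp_word \<alpha> \<noteq> []" using that \<open>d \<ge> 1\<close> by (metis length_exp_word list.size(3) not_one_le_zero)
      then show ?thesis unfolding P0 by (intro truncated_polar_eq_polar[OF frame sa]) simp
    qed
    also have "\<dots> = h \<alpha>" by (simp add: polar_axis)
    finally show ?thesis .
  qed

  obtain \<kappa> where \<kappa>: "\<And>c m. m \<le> n \<Longrightarrow> c m = (\<Sum>i\<le>m. \<kappa> m i * (\<Sum>l\<le>n. c l * newton ?\<sigma> l (?\<sigma> i)))"
    using newton_coeffs_from_values[OF inj_\<sigma>] by blast
  define H where "H m i \<alpha> = twisted_polar ?hL (TL m)
      (map (\<lambda>l. eigenspace_map ?\<sigma> n CL i *v axis l 1) (exp_word \<alpha>))" for m i \<alpha>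
  have H: "\<phi> (poly (P m \<alpha>) (s i)) = H m i \<alpha>" for m i \<alpha>
  proof -
    interpret V: ring_hom "\<lambda>p. \<phi> (poly p (s i))" by (rule \<phi>.ring_hom_poly)
    have M: "map_matrix (\<lambda>p. \<phi> (poly p (s i))) (map_matrix c M) = map_matrix (\<lambda>x. \<phi> (\<iota> x)) M" for M :: "'k ^ 'r ^ 'r"
      by (simp add: vec_eq_iff c_def)
    have "map_matrix (\<lambda>p. \<phi> (poly p (s i))) Q = eigenspace_map ?\<sigma> n CL i"
      by (simp add: Q_def V.weighted_sum V.newton M eigenspace_map_def CL_def)
    then show ?thesis
      by (simp add: P_def H_def V.twisted_polar M comp_def V.matrix_vec V.axis_1 TL_def c_def)
  qed
  define g where "g i \<alpha> = (\<Sum>m\<in>{i..n}. \<kappa> m i * H m i \<alpha>)" for i \<alpha>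
  have F0_split: "\<phi> (F0 \<alpha>) = (\<Sum>i\<le>n. g i \<alpha>)" for \<alpha>
  proof -
    have "\<phi> (newton_coeff s m p) = (\<Sum>i\<le>m. \<kappa> m i * \<phi> (poly p (s i)))" if "m \<le> n" for m p
    proof -
      have "\<phi> (poly p (s i)) = (\<Sum>l\<le>n. \<phi> (newton_coeff s l p) * newton ?\<sigma> l (?\<sigma> i))" if "i \<le> n" for i
        by (simp add: newton_interpolation[OF that] \<phi>.sum \<phi>.mult \<phi>.newton)
      then show ?thesis using \<kappa>[OF that, of "\<lambda>l. \<phi> (newton_coeff s l p)"] that by simp
    qed
    then have "\<phi> (F0 \<alpha>) = (\<Sum>m\<le>n. \<Sum>i\<le>m. \<kappa> m i * H m i \<alpha>)"
      by (simp add: F0_def \<phi>.sum H)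
    also have "\<dots> = (\<Sum>i\<le>n. g i \<alpha>)"
      unfolding g_def sum.Sigma[OF finite_atMost ballI, OF finite_atMost]
        sum.Sigma[OF finite_atMost ballI, OF finite_atLeastAtMost]
      by (rule sum.reindex_bij_witness[of _ "\<lambda>(x, y). (y, x)" "\<lambda>(x, y). (y, x)"]) auto
    finally show ?thesis .
  qed
  have g_component: "component_form ?\<sigma> n TL CL i (g i)" for i
    unfolding g_def[abs_def] H_def
    by (intro component_form_sum component_form_scale component_form_twisted_polar frameL saL) simp

  \<comment> \<open>the forms \<open>\<tau>\<lambda>\<^sup>(\<^sup>d\<^sup>)\<close> that replace vanishing components; \<open>\<lambda>\<close> is row \<open>p i\<close> of \<open>M i\<close>\<close>
  define M where "M i = map_matrix \<iota> (T i) ** eigenspace_map s n (\<lambda>j. map_matrix \<iota> (C j)) i" for i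
  have "\<exists>p l. M i $ p $ l \<noteq> 0" if "i \<le> n" for i
  proof -
    have "T i ** C 0 \<noteq> 0" by (rule chain_frame_nonzero[OF frame \<open>T n \<noteq> 0\<close> that])
    then obtain p l where "(T i ** C 0) $ p $ l \<noteq> 0" by (auto simp: vec_eq_iff)
    then have "\<iota> ((T i ** C 0) $ p $ l) \<noteq> 0" using \<epsilon>\<iota> by (metis \<epsilon>.zero)
    then have "map_matrix \<iota> (T i) ** map_matrix \<iota> (C 0) \<noteq> 0"
      by (auto simp: vec_eq_iff simp flip: \<iota>.matrix_mul)
    from eigenspace_map_nonzero[OF frameP this]
    show ?thesis by (auto simp: M_def vec_eq_iff)
  qed
  then obtain p q where pq: "\<And>i. i \<le> n \<Longrightarrow> M i $ p i $ q i \<noteq> 0" by metis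
  define e where "e i \<alpha> = \<tau> * (\<Prod>l\<leftarrow>exp_word \<alpha>. M i $ p i $ l)" for i \<alpha>
  have \<phi>M: "map_matrix \<phi> (M i) = TL i ** eigenspace_map ?\<sigma> n CL i" for i
  proof -
    have "map_matrix \<phi> (map_matrix \<iota> N) = map_matrix (\<lambda>x. \<phi> (\<iota> x)) N" for N :: "'k ^ 'r ^ 'r"
      by (simp add: vec_eq_iff)
    then show ?thesis
      by (simp add: M_def \<phi>.matrix_mul \<phi>.eigenspace_map TL_def CL_def)
  qed
  have \<phi>e: "\<phi> (e i \<alpha>) = \<phi> \<tau> * (\<Prod>l\<leftarrow>exp_word \<alpha>. (TL i ** eigenspace_map ?\<sigma> n CL i) $ p i $ l)" for i \<alpha>
    by (simp add: e_def \<phi>.mult \<phi>.prod_list comp_def flip: \<phi>M)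
  have e_component: "component_form ?\<sigma> n TL CL i (\<lambda>\<alpha>. \<phi> (e i \<alpha>))" for i
    unfolding \<phi>e by (intro component_form_scale component_form_power)
  have e_nonzero: "\<exists>\<alpha>. mdeg \<alpha> = d \<and> \<phi> (e i \<alpha>) \<noteq> 0" if "i \<le> n" for i
  proof -
    \<comment> \<open>the coefficient of \<open>x\<^sub>q\<^sup>(\<^sup>d\<^sup>)\<close> is \<open>\<tau>\<close> times the \<open>d\<close>-th power of an entry of \<open>\<lambda>\<close>\<close>
    let ?w = "replicate d (q i)"
    have "mset (exp_word (word_exp ?w)) = mset ?w" by (rule mset_eq_if_word_exp_eq) simp
    then have "(\<Prod>l\<leftarrow>exp_word (word_exp ?w). M i $ p i $ l) = (\<Prod>l\<leftarrow>?w. M i $ p i $ l)"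
      by (metis mset_map prod_mset_prod_list)
    then have "e i (word_exp ?w) = \<tau> * (M i $ p i $ q i) ^ d" by (simp add: e_def)
    then have "e i (word_exp ?w) \<noteq> 0" using pq[OF that] \<tau> by simp
    then have "\<phi> (e i (word_exp ?w)) \<noteq> 0" using inj_\<phi> by (metis \<phi>.zero injD)
    then show ?thesis by (intro exI[of _ "word_exp ?w"]) (simp add: mdeg_word_exp)
  qed

  define Z where "Z = {i. \<forall>\<alpha>. mdeg \<alpha> = d \<longrightarrow> g i \<alpha> = 0}"
  define G where "G i \<alpha> = g i \<alpha> + (if i \<in> Z then \<phi> (e i \<alpha>) else 0)" for i \<alpha>
  define F where "F \<alpha> = F0 \<alpha> + (\<Sum>i\<le>n. if i \<in> Z then e i \<alpha> else 0)" for \<alpha>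
  have "\<epsilon> (if i \<in> Z then e i \<alpha> else 0) = 0" for i \<alpha>
    by (simp add: e_def \<epsilon>.mult \<tau>)
  then have "\<epsilon> (F \<alpha>) = h \<alpha>" if "mdeg \<alpha> = d" for \<alpha>
    unfolding F_def \<epsilon>.add F0_special[OF that] \<epsilon>.sum by simp
  moreover have "\<phi> (F \<alpha>) = (\<Sum>i\<le>n. G i \<alpha>)" for \<alpha>
  proof -
    have "\<phi> (if i \<in> Z then e i \<alpha> else 0) = (if i \<in> Z then \<phi> (e i \<alpha>) else 0)" for i by simp
    then show ?thesis unfolding F_def G_def \<phi>.add F0_split \<phi>.sum sum.distrib by simp
  qed
  moreover have "\<exists>\<alpha>. mdeg \<alpha> = d \<and> G i \<alpha> \<noteq> 0" if "i \<le> n" for i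
  proof (cases "i \<in> Z")
    case True
    then show ?thesis using e_nonzero[OF that] by (auto simp: G_def Z_def)
  next
    case False
    then show ?thesis by (auto simp: G_def Z_def)
  qed
  moreover have "component_form ?\<sigma> n TL CL i (G i)" for i
    unfolding G_def[abs_def]
    using component_form_add[OF g_component e_component] g_component by (cases "i \<in> Z") auto
  ultimately show ?thesis by blast
qed

section \<open>Regular splittings from eigenspaces\<close>

definition form :: "nat \<Rightarrow> (('r::finite \<Rightarrow>\<^sub>0 nat) \<Rightarrow> 'a::zero) \<Rightarrow> ('r \<Rightarrow>\<^sub>0 nat) \<Rightarrow>\<^sub>0 'a" where
  "form d h = Abs_poly_mapping (\<lambda>\<alpha>. if mdeg \<alpha> = d then h \<alpha> else 0)"

lemma lookup_form: "Poly_Mapping.lookup (form d h) \<alpha> = (if mdeg \<alpha> = d then h \<alpha> else 0)"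
proof -
  have "finite {\<alpha>. (if mdeg \<alpha> = d then h \<alpha> else 0) \<noteq> 0}"
    by (rule finite_subset[OF _ finite_mdeg_eq[of d]]) auto
  then show ?thesis unfolding form_def by simp
qed

lemma form_homog: "form d h \<in> homog d"
  by (auto simp: homog_def in_keys_iff lookup_form split: if_splits)

lemma lookup_map_0:
  assumes "f 0 = 0"
  shows "Poly_Mapping.lookup (Poly_Mapping.map f p) k = f (Poly_Mapping.lookup p k)"
  using assms by transfer (auto simp: when_def)

lemma unit_exp_eq_iff: "Poly_Mapping.single k (Suc 0) = Poly_Mapping.single l (Suc 0) \<longleftrightarrow> k = l"
  by (metis lookup_single_eq lookup_single_not_eq nat.distinct(1))

text \<open>
  An operator of degree \<open>d - 1\<close> is a linear combination of monomials, and the functionals that belong to these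
  monomials combine to a single one.
\<close>

lemma derivs_form:
  assumes "component_form s n T C i g" and "d \<ge> 1" and "x \<in> derivs (d - 1) (form d g)"
  shows "\<exists>a. \<forall>\<alpha>. Poly_Mapping.lookup x \<alpha> =
     (\<Sum>l\<in>UNIV. if \<alpha> = unit_exp l then dotv a (T i *v (eigenspace_map s n C i *v axis l 1)) else 0)"
proof -
  from assms(3) obtain D where D: "x = act D (form d g)" "D \<in> homog (d - 1)"
    by (auto simp: derivs_def)
  obtain a where a: "\<And>\<beta> l. g (\<beta> + unit_exp l) = dotv (a \<beta>) (T i *v (eigenspace_map s n C i *v axis l 1))"
    using assms(1) unfolding component_form_def by metis
  let ?a = "\<Sum>\<beta>\<in>Poly_Mapping.keys D. Poly_Mapping.lookup D \<beta> *s a \<beta>"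
  have deg: "mdeg \<beta> = d - 1" if "\<beta> \<in> Poly_Mapping.keys D" for \<beta>
    using D(2) that by (simp add: homog_def)
  have "Poly_Mapping.lookup x \<alpha> = (\<Sum>l\<in>UNIV. if \<alpha> = unit_exp l then
      dotv ?a (T i *v (eigenspace_map s n C i *v axis l 1)) else 0)" for \<alpha>
  proof (cases "mdeg \<alpha> = 1")
    case True
    obtain k where k: "\<alpha> = unit_exp k"
    proof -
      have "length (exp_word \<alpha>) = 1" using True by simp
      then obtain k where "exp_word \<alpha> = [k]" by (metis One_nat_def length_0_conv length_Suc_conv)
      then have "\<alpha> = unit_exp k" by (metis word_exp_Cons word_exp_Nil add.right_neutral word_exp_exp_word)
      then show thesis by (rule that)
    qed
    have "Poly_Mapping.lookup x \<alpha> = (\<Sum>\<beta>\<in>Poly_Mapping.keys D. Poly_Mapping.lookup D \<beta> * g (\<beta> + unit_exp k))"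
      unfolding D(1) lookup_act pairing_def using deg \<open>d \<ge> 1\<close>
      by (intro sum.cong) (auto simp: lookup_form k mdeg_add add.commute)
    also have "\<dots> = dotv ?a (T i *v (eigenspace_map s n C i *v axis k 1))"
      unfolding a dotv_left_sum dotv_left_scale ..
    also have "\<dots> = (\<Sum>l\<in>UNIV. if k = l then
        dotv ?a (T i *v (eigenspace_map s n C i *v axis l 1)) else 0)" by simp
    also have "\<dots> = (\<Sum>l\<in>UNIV. if \<alpha> = unit_exp l then
        dotv ?a (T i *v (eigenspace_map s n C i *v axis l 1)) else 0)"
      unfolding k by (intro sum.cong) (auto simp: unit_exp_eq_iff)
    finally show ?thesis .
  next
    case False
    then have "Poly_Mapping.lookup x \<alpha> = 0"
      unfolding D(1) lookup_act pairing_def using deg \<open>d \<ge> 1\<close>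
      by (intro sum.neutral) (auto simp: lookup_form mdeg_add)
    moreover have "\<alpha> \<noteq> unit_exp l" for l using False by auto
    ultimately show ?thesis by simp
  qed
  then show ?thesis by blast
qed

text \<open>
  A linear form in the intersection gives a relation between linear forms on the different
  eigenspaces, which is trivial by independence.
\<close>

lemma splits_regularly_components:
  fixes T C :: "nat \<Rightarrow> 'l::field ^ 'r ^ 'r::finite" and F :: "('r, 'l) dpow"
  assumes frame: "chain_frame T n C" and inj: "inj_on s {..n}" and "d \<ge> 1"
    and comp: "\<And>i. i \<le> n \<Longrightarrow> component_form s n T C i (G i)"
    and nz: "\<And>i. i \<le> n \<Longrightarrow> \<exists>\<alpha>. mdeg \<alpha> = d \<and> G i \<alpha> \<noteq> 0"
    and F: "F = (\<Sum>i\<le>n. form d (G i))"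
  shows "splits_regularly d n F"
  unfolding splits_regularly_def
proof (intro exI[of _ "\<lambda>i. form d (G (i - 1))"] conjI ballI)
  show "F = (\<Sum>i\<in>{1..n+1}. form d (G (i - 1)))"
    unfolding F
    by (rule sum.reindex_bij_witness[of _ "\<lambda>i. i - 1" Suc]) auto
  fix i assume i: "i \<in> {1..n+1}"
  then have i': "i - 1 \<le> n" by auto
  show "form d (G (i - 1)) \<in> homog d" by (rule form_homog)
  show "form d (G (i - 1)) \<noteq> 0"
    using nz[OF i'] by (metis lookup_form lookup_zero)
  have zero: "0 \<in> derivs (d - 1) (g :: ('r, 'l) dpow)" for g
    unfolding derivs_def by (auto simp: act_def homog_def intro!: exI[of _ 0])
  show "derivs (d - 1) (form d (G (i - 1))) \<inter> (\<Sum>j\<in>{1..n+1} - {i}. derivs (d - 1) (form d (G (j - 1)))) = {0}"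
  proof (intro equalityI subsetI)
    fix x assume "x \<in> derivs (d - 1) (form d (G (i - 1))) \<inter> (\<Sum>j\<in>{1..n+1} - {i}. derivs (d - 1) (form d (G (j - 1))))"
    then have x: "x \<in> derivs (d - 1) (form d (G (i - 1)))"
      and "x \<in> (\<Sum>j\<in>{1..n+1} - {i}. derivs (d - 1) (form d (G (j - 1))))" by blast+
    from this(2) obtain y where y: "x = sum y ({1..n+1} - {i})"
      "\<And>j. j \<in> {1..n+1} - {i} \<Longrightarrow> y j \<in> derivs (d - 1) (form d (G (j - 1)))"
      unfolding set_sum_alt[OF finite_Diff[OF finite_atLeastAtMost]] by blast
    \<comment> \<open>the relation \<open>x = \<Sum>\<^sub>j\<^sub>\<noteq>\<^sub>i y j\<close>, written as \<open>\<Sum>\<^sub>j z j = 0\<close>\<close>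
    define z where "z j = (if j = i then - x else y j)" for j
    let ?E = "\<lambda>j l. T (j - 1) *v (eigenspace_map s n C (j - 1) *v axis l 1)"
    have "\<exists>a. \<forall>\<alpha>. Poly_Mapping.lookup (z j) \<alpha> =
        (\<Sum>l\<in>UNIV. if \<alpha> = unit_exp l then dotv a (?E j l) else 0)" if j: "j \<in> {1..n+1}" for j
    proof (cases "j = i")
      case True
      from derivs_form[OF comp[OF i'] \<open>d \<ge> 1\<close> x]
      obtain a where "\<And>\<alpha>. Poly_Mapping.lookup x \<alpha> = (\<Sum>l\<in>UNIV. if \<alpha> = unit_exp l then dotv a (?E j l) else 0)"
        using True by auto
      then have "Poly_Mapping.lookup (z j) \<alpha> = (\<Sum>l\<in>UNIV. if \<alpha> = unit_exp l then dotv ((-1) *s a) (?E j l) else 0)" for \<alpha>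
        unfolding dotv_left_scale using True by (simp add: z_def if_distrib flip: sum_negf cong: if_cong)
      then show ?thesis by blast
    next
      case False
      then show ?thesis using derivs_form[OF comp \<open>d \<ge> 1\<close> y(2)] j by (auto simp: z_def)
    qed
    then have "\<forall>j\<in>{1..n+1}. \<exists>a. \<forall>\<alpha>. Poly_Mapping.lookup (z j) \<alpha> =
        (\<Sum>l\<in>UNIV. if \<alpha> = unit_exp l then dotv a (?E j l) else 0)" by blast
    from bchoice[OF this] obtain a where a: "\<And>j \<alpha>. j \<in> {1..n+1} \<Longrightarrow> Poly_Mapping.lookup (z j) \<alpha> =
        (\<Sum>l\<in>UNIV. if \<alpha> = unit_exp l then dotv (a j) (?E j l) else 0)" by blast
    have a_unit: "Poly_Mapping.lookup (z j) (unit_exp k) = dotv (a j) (?E j k)" if "j \<in> {1..n+1}" for j k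
    proof -
      have "Poly_Mapping.lookup (z j) (unit_exp k) = (\<Sum>l\<in>UNIV. if k = l then dotv (a j) (?E j l) else 0)"
        unfolding a[OF that] by (intro sum.cong) (auto simp: unit_exp_eq_iff)
      then show ?thesis by simp
    qed
    have z_sum: "(\<Sum>j\<in>{1..n+1}. z j) = 0"
    proof -
      have "(\<Sum>j\<in>{1..n+1}. z j) = z i + (\<Sum>j\<in>{1..n+1} - {i}. z j)"
        using i by (intro sum.remove) auto
      also have "(\<Sum>j\<in>{1..n+1} - {i}. z j) = x" unfolding y(1) by (intro sum.cong) (auto simp: z_def)
      finally show ?thesis by (simp add: z_def)
    qed
    have unit: "(\<Sum>j\<le>n. dotv (a (Suc j)) (T j *v (eigenspace_map s n C j *v axis k 1))) = 0" for k
    proof -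
      have "0 = (\<Sum>j\<in>{1..n+1}. Poly_Mapping.lookup (z j) (unit_exp k))"
        using z_sum by (simp flip: lookup_sum)
      also have "\<dots> = (\<Sum>j\<le>n. dotv (a (Suc j)) (T j *v (eigenspace_map s n C j *v axis k 1)))"
        by (rule sum.reindex_bij_witness[of _ Suc "\<lambda>i. i - 1"]) (auto simp: a_unit simp del: One_nat_def)
      finally show ?thesis ..
    qed
    have "(\<Sum>j\<le>n. dotv (a (Suc j)) (T j *v (eigenspace_map s n C j *v v))) = 0" for v
    proof -
      have lin: "dotv b (M *v v) = (\<Sum>k\<in>UNIV. v $ k * dotv b (M *v axis k 1))" for b and M :: "'l ^ 'r ^ 'r"
        by (subst (1) basis_expansion[of v, symmetric])
          (simp add: matrix_vector_sum_right matrix_vector_scale dotv_right_sum dotv_right_scale)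
      have "(\<Sum>j\<le>n. dotv (a (Suc j)) (T j *v (eigenspace_map s n C j *v v))) =
        (\<Sum>k\<in>UNIV. v $ k * (\<Sum>j\<le>n. dotv (a (Suc j)) (T j *v (eigenspace_map s n C j *v axis k 1))))"
        unfolding matrix_vector_mul_assoc sum_distrib_left
        by (subst sum.swap) (intro sum.cong refl lin)
      then show ?thesis by (simp add: unit)
    qed
    from eigenspaces_independent[OF frame inj this i']
    have "dotv (a i) (?E i k) = 0" for k using i by auto
    then have "Poly_Mapping.lookup (z i) \<alpha> = 0" for \<alpha>
      unfolding a[OF i] by (intro sum.neutral) (simp del: One_nat_def)
    then have "z i = 0" by (intro poly_mapping_eqI) simp
    then have "x = 0" by (simp add: z_def)
    then show "x \<in> {0}" by simp
  next
    fix x :: "('r, 'l) dpow" assume "x \<in> {0}"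
    moreover have "0 \<in> (\<Sum>j\<in>{1..n+1} - {i}. derivs (d - 1) (form d (G (j - 1))))"
      unfolding set_sum_alt[OF finite_Diff[OF finite_atLeastAtMost]]
      using zero by (intro CollectI exI[of _ "\<lambda>_. 0"]) simp
    ultimately show "x \<in> derivs (d - 1) (form d (G (i - 1))) \<inter> (\<Sum>j\<in>{1..n+1} - {i}. derivs (d - 1) (form d (G (j - 1))))"
      using zero by simp
  qed
qed

section \<open>Polynomial and rational function coefficients\<close>

lemma eval_tpoly_0:
  fixes p :: "('n::finite, 'k::field) tpoly"
  shows "eval_tpoly (\<lambda>_. 0) p = Poly_Mapping.lookup p 0"
proof -
  have "(\<Prod>i\<in>UNIV. (0::'k) ^ Poly_Mapping.lookup m i) = (if m = 0 then 1 else 0)" for m :: "'n \<Rightarrow>\<^sub>0 nat"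
    by (auto simp: poly_mapping_eq_iff fun_eq_iff power_0_left)
  then show ?thesis
    unfolding eval_tpoly_def by (simp only:) (simp add: in_keys_iff if_distrib cong: if_cong)
qed

lemma ring_hom_eval_0: "ring_hom (eval_tpoly (\<lambda>_. 0) :: ('n::finite, 'k::field) tpoly \<Rightarrow> 'k)"
proof
  fix x y :: "('n, 'k) tpoly"
  show "eval_tpoly (\<lambda>_. 0) (x * y) = eval_tpoly (\<lambda>_. 0) x * eval_tpoly (\<lambda>_. 0) y"
  proof -
    have sum_0: "l + q = 0 \<longleftrightarrow> l = 0 \<and> q = 0" for l q :: "'n \<Rightarrow>\<^sub>0 nat"
      by (metis add.right_neutral add_is_0 lookup_add lookup_zero poly_mapping_eqI)
    have "(\<Sum>q. Poly_Mapping.lookup y q when 0 = l + q) = (Poly_Mapping.lookup y 0 when l = 0)" for l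
    proof (cases "l = 0")
      case False
      then have "0 \<noteq> l + q" for q using sum_0[of l q] by auto
      then show ?thesis using False by simp
    qed simp
    then have "Poly_Mapping.lookup (x * y) 0 = Poly_Mapping.lookup x 0 * Poly_Mapping.lookup y 0"
      by (simp add: lookup_mult mult_when)
    then show ?thesis by (simp add: eval_tpoly_0)
  qed
qed (simp_all add: eval_tpoly_0 lookup_add)

lemma ring_hom_Fract: "ring_hom (\<lambda>c. Fract c 1)"
  by unfold_locales (simp_all add: One_fract_def)

lemma ring_hom_single_0: "ring_hom (Poly_Mapping.single 0 :: 'k::comm_ring_1 \<Rightarrow> ('n \<Rightarrow>\<^sub>0 nat) \<Rightarrow>\<^sub>0 'k)"
  by unfold_locales (simp_all add: single_add mult_single)

section \<open>Deformation of a form with a nilpotent matrix\<close>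

theorem theorem4p5:
  fixes f :: "('r::finite, 'k::field) dpow"
    and A :: "'k ^ 'r ^ 'r"
    and d :: nat
  assumes "d \<ge> 3"
    and "f \<in> homog d"
    and "A \<in> M_set f"
    and "A \<noteq> 0"
    and "nilpotent_mat A"
    and "CARD('n::{finite,linorder}) = nil_index A - 1"
  shows "\<exists>ft :: ('r, ('n, 'k) tpoly) dpow.
           ft \<in> homog d \<and>
           specialize (\<lambda>_. 0) ft = f \<and>
           splits_regularly d (nil_index A - 1) (to_tfrac ft)"
proof -
  define n where "n = nil_index A - 1"
  obtain k where "mat_power A k = 0" using \<open>nilpotent_mat A\<close> by (auto simp: nilpotent_mat_def)
  then have "\<exists>k. 1 \<le> k \<and> mat_power A k = 0"
    using mat_power_eq_0_mono[of A k "Suc k"] by (intro exI[of _ "Suc k"]) simp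
  from LeastI_ex[OF this] have idx: "1 \<le> nil_index A" "mat_power A (nil_index A) = 0"
    by (simp_all add: nil_index_def)
  have n1: "n \<ge> 1"
    using assms(6) zero_less_card_finite[where 'a = 'n] by (simp add: n_def)
  have Sn: "nil_index A = Suc n" using idx(1) by (simp add: n_def)
  have An: "mat_power A n \<noteq> 0"
    using not_less_Least[of n "\<lambda>k. 1 \<le> k \<and> mat_power A k = 0"] n1 Sn
    by (auto simp: nil_index_def)
  define T where "T = mat_power (transpose A)"
  have T: "T m = transpose (mat_power A m)" for m by (simp add: T_def mat_power_transpose)
  have TS: "T (Suc n) = 0" using idx(2) by (simp add: T Sn vec_eq_iff transpose_def)
  have Tn: "T n \<noteq> 0" using An by (auto simp: T vec_eq_iff transpose_def)
  obtain C where "chain_system (transpose A) (mat 1) n C"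
    using chain_system_exists[of "mat 1" "transpose A" n] TS by (auto simp: T_def)
  then have frame: "chain_frame T n C"
    using TS by (simp add: chain_system_def chain_frame_def T_def mat_power_add)
  have sa: "self_adjoint (Poly_Mapping.lookup f) (T m)" for m
    unfolding T_def by (intro self_adjoint_mat_power M_set_self_adjoint assms(3))

  obtain t :: "nat \<Rightarrow> 'n" where t: "bij_betw t {1..n} UNIV"
    using finite_same_card_bij[of "{1..n}" "UNIV :: 'n set"] assms(6) by (auto simp: n_def)
  \<comment> \<open>with \<open>0\<close> as a node, \<open>n\<close> parameters give the \<open>n + 1\<close> distinct nodes \<open>0, t\<^sub>1, \<dots>, t\<^sub>n\<close>\<close>
  define s :: "nat \<Rightarrow> ('n, 'k) tpoly" where
    "s l = (if l \<in> {1..n} then Poly_Mapping.single (unit_exp (t l)) 1 else 0)" for l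
  have s0: "eval_tpoly (\<lambda>_. 0) (s l) = 0" for l
    by (simp add: eval_tpoly_0 s_def lookup_single when_def poly_mapping_eq_iff fun_eq_iff)
  have s_nz: "s l \<noteq> 0" if "l \<in> {1..n}" for l
    using that unfolding s_def by (metis lookup_single_eq lookup_zero zero_neq_one)
  have "inj_on s {..n}"
  proof (rule inj_onI)
    fix l l' assume l: "l \<in> {..n}" "l' \<in> {..n}" "s l = s l'"
    consider "l = 0" | "l' = 0" | "l \<in> {1..n}" "l' \<in> {1..n}" using l by fastforce
    then show "l = l'"
    proof cases
      case 1
      then show ?thesis using s_nz[of l'] l by (cases "l' = 0") (auto simp: s_def)
    next
      case 2
      then show ?thesis using s_nz[of l] l by (cases "l = 0") (auto simp: s_def)
    next
      case 3
      then have "Poly_Mapping.lookup (s l) (unit_exp (t l)) = 1" by (simp add: s_def)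
      with l(3) have "Poly_Mapping.lookup (s l') (unit_exp (t l)) = 1" by simp
      with 3 have "unit_exp (t l') = unit_exp (t l)"
        unfolding s_def by (metis lookup_single_not_eq zero_neq_one)
      then have "t l' = t l" by (simp add: unit_exp_eq_iff)
      then show ?thesis using t 3 by (auto simp: bij_betw_def dest: inj_onD)
    qed
  qed
  note inj_s = this
  have inj_Fract: "inj (\<lambda>c :: ('n, 'k) tpoly. Fract c 1)"
    by (auto simp: inj_def eq_fract)
  let ?\<iota> = "Poly_Mapping.single 0 :: 'k \<Rightarrow> ('n, 'k) tpoly"
  let ?\<phi> = "\<lambda>c :: ('n, 'k) tpoly. Fract c 1"
  interpret \<phi>: ring_hom ?\<phi> by (rule ring_hom_Fract)
  interpret \<phi>\<iota>: ring_hom "\<lambda>x. ?\<phi> (?\<iota> x)"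
    by (rule ring_hom_comp[OF ring_hom_single_0 ring_hom_Fract])
  have one: "1 \<in> {1..n}" and d1: "1 \<le> d" using n1 \<open>d \<ge> 3\<close> by simp_all
  have "eval_tpoly (\<lambda>_. 0) (?\<iota> x) = x" for x by (simp add: eval_tpoly_0)
  from splitting_family[OF ring_hom_single_0 ring_hom_eval_0 ring_hom_Fract this inj_Fract s0 inj_s
      s0 s_nz[OF one] frame Tn sa d1]
  obtain F G where FG: "\<forall>\<alpha>. mdeg \<alpha> = d \<longrightarrow>
        eval_tpoly (\<lambda>_. 0) (F \<alpha>) = Poly_Mapping.lookup f \<alpha> \<and> ?\<phi> (F \<alpha>) = (\<Sum>i\<le>n. G i \<alpha>)"
    "\<forall>i\<le>n. (\<exists>\<alpha>. mdeg \<alpha> = d \<and> G i \<alpha> \<noteq> 0) \<and>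
        component_form (\<lambda>l. ?\<phi> (s l)) n (\<lambda>m. map_matrix (\<lambda>x. ?\<phi> (?\<iota> x)) (T m))
          (\<lambda>m. map_matrix (\<lambda>x. ?\<phi> (?\<iota> x)) (C m)) i (G i)"
    by (elim exE conjE)
  have "specialize (\<lambda>_. 0) (form d F) = f"
  proof (rule poly_mapping_eqI)
    fix \<alpha>
    show "Poly_Mapping.lookup (specialize (\<lambda>_. 0) (form d F)) \<alpha> = Poly_Mapping.lookup f \<alpha>"
      using FG(1) \<open>f \<in> homog d\<close>
      by (auto simp: specialize_def lookup_map_0 eval_tpoly_0 lookup_form homog_def in_keys_iff)
  qed
  moreover have "splits_regularly d n (to_tfrac (form d F))"
  proof (rule splits_regularly_components[OF \<phi>\<iota>.chain_frame[OF frame] _ d1])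
    show "inj_on (\<lambda>l. ?\<phi> (s l)) {..n}"
      using inj_s inj_Fract by (auto simp: inj_on_def)
    show "\<exists>\<alpha>. mdeg \<alpha> = d \<and> G i \<alpha> \<noteq> 0"
      and "component_form (\<lambda>l. ?\<phi> (s l)) n (\<lambda>m. map_matrix (\<lambda>x. ?\<phi> (?\<iota> x)) (T m))
          (\<lambda>m. map_matrix (\<lambda>x. ?\<phi> (?\<iota> x)) (C m)) i (G i)" if "i \<le> n" for i
      using FG(2) that by blast+
    show "to_tfrac (form d F) = (\<Sum>i\<le>n. form d (G i))"
      using FG(1)
      by (intro poly_mapping_eqI) (simp add: to_tfrac_def lookup_map_0 lookup_sum lookup_form flip: Zero_fract_def)
  qed
  ultimately show ?thesis using form_homog unfolding n_def by blast
qed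

end
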